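(* Let $\mu\in\mathcal{P}(\Theta)$, and let $\Phi_1,\Phi_2\in L^0(\Theta,\mathbb{R})$ be such that $\mu_{\Phi_i}\in\mathcal{P}_1(\Theta)$ for $i=1,2$. (i) If $R(\mu)$ is finite and $\operatorname{ess\,inf}_\mu\Phi_i=0$ for $i=1,2$, then $$\mathrm{W}_1(\mu_{\Phi_1},\mu_{\Phi_2})\leq\frac{R(\mu)}{Z_{\Phi_1,\mu}\vee Z_{\Phi_2,\mu}}\left(\Vert e^{-\Phi_1}-e^{-\Phi_2}\Vert_{L^1_\mu}+|Z_{\Phi_1,\mu}-Z_{\Phi_2,\mu}|\right),$$ where equality holds if $\Phi_1=\Phi_2$ $\mu$-a.s., but not if $\Phi_1-\Phi_2=c$ $\mu$-a.s. for some $c\neq 0$. If in addition $\Phi_i\in L^1_\mu(\Theta,\mathbb{R})$ for $i=1,2$, then $$\mathrm{W}_1(\mu_{\Phi_1},\mu_{\Phi_2})\leq\frac{R(\mu)}{Z_{\Phi_1,\mu}\vee Z_{\Phi_2,\mu}}\left(\Vert\Phi_1-\Phi_2\Vert_{L^1_\mu}+|Z_{\Phi_1,\mu}-Z_{\Phi_2,\mu}|\right).$$ (ii) It holds that $$\mathrm{W}_1(\mu_{\Phi_1},\mu_{\Phi_2})=\frac{1}{Z_{\Phi_1,\mu}}\sup_{\Vert f\Vert_{\mathrm{Lip}}\leq 1}\left|\int f\left(e^{-\Phi_1}-e^{-\Phi_2}\right)\mathrm{d}\mu+\int f\,\mathrm{d}\mu_{\Phi_2}\,(Z_{\Phi_2,\mu}-Z_{\Phi_1,\mu})\right|,$$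 where the supremum is over functions $f:\Theta\to\mathbb{R}$ with $\Vert f\Vert_{\mathrm{Lip}(\Theta,d)}\leq 1$, and the supremum is attained. If $Z_{\Phi_1,\mu}=Z_{\Phi_2,\mu}$ and $0<\Vert e^{-\Phi_1}-e^{-\Phi_2}\Vert_{\mathrm{Lip}(\operatorname{supp}\mu,d)}<\infty$, then $$\mathrm{W}_1(\mu_{\Phi_1},\mu_{\Phi_2})\geq\frac{1}{Z_{\Phi_1,\mu}}\,\frac{\Vert e^{-\Phi_1}-e^{-\Phi_2}\Vert_{L^2_\mu}^2}{\Vert e^{-\Phi_1}-e^{-\Phi_2}\Vert_{\mathrm{Lip}(\operatorname{supp}\mu,d)}},$$ and if in addition $\Phi_i\in L^\infty_\mu(\Theta,\mathbb{R})$ for $i=1,2$, then $$\mathrm{W}_1(\mu_{\Phi_1},\mu_{\Phi_2})\geq\frac{\exp(-2\Vert\Phi_1\Vert_{L^\infty_\mu})\wedge\exp(-2\Vert\Phi_2\Vert_{L^\infty_\mu})}{Z_{\Phi_1,\mu}}\,\frac{\Vert\Phi_1-\Phi_2\Vert_{L^2_\mu}^2}{\Vert e^{-\Phi_1}-e^{-\Phi_2}\Vert_{\mathrm{Lip}(\operatorname{supp}\mu,d)}}.$$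
   Context: $(\Theta,d)$ is a Polish space with metric $d$ and Borel $\sigma$-algebra; $\mathcal{P}(\Theta)$ is the set of Borel probability measures on it. $L^0(\Theta,\mathbb{R})$ is the set of measurable functions $\Theta\to\mathbb{R}$, and $L^p_\mu(\Theta,\mathbb{R})$ the set of those with finite $L^p(\mu)$-norm. For $\Phi\in L^0(\Theta,\mathbb{R})$ and $\mu\in\mathcal{P}(\Theta)$: $Z_{\Phi,\mu}:=\int e^{-\Phi}\,\mathrm{d}\mu$; if $0<Z_{\Phi,\mu}<\infty$, then $\mu_\Phi$ is the probability measure with $\frac{\mathrm{d}\mu_\Phi}{\mathrm{d}\mu}=e^{-\Phi}/Z_{\Phi,\mu}$ (a requirement such as $\mu_\Phi\in\mathcal{P}_1(\Theta)$ includes $0<Z_{\Phi,\mu}<\infty$). $\mathcal{P}_1(\Theta)$ is the set of $\mu\in\mathcal{P}(\Theta)$ with $\int d(x_0,x)\,\mu(\mathrm{d}x)<\infty$ for some (equivalently, any) $x_0\in\Theta$. $\mathrm{W}_1(\mu,\nu):=\inf_{\pi\in\Pi(\mu,\nu)}\int d(x,y)\,\mathrm{d}\pi(x,y)$, where $\Pi(\mu,\nu)$ is the set of couplings of $\mu$ and $\nu$. For a measure $\mu$, $\operatorname{supp}\mu$ is its support and $R(\mu):=\operatorname{diam}(\operatorname{supp}\mu)=\sup_{x,y\in\operatorname{supp}\mu}d(x,y)$. For $M\subset\Theta$ and $f$ real-valued on $M$ (or on a superset of $M$), $\Vert f\Vert_{\mathrm{Lip}(M,d)}:=\sup_{x\neq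 y\in M}\frac{|f(x)-f(y)|}{d(x,y)}$. $a\wedge b:=\min\{a,b\}$, $a\vee b:=\max\{a,b\}$. *)

theory Defs
  imports "HOL-Probability.Probability"
begin

text \<open>
  The Polish space \<open>\<Theta>\<close> is a type of class \<^class>\<open>polish_space\<close>, with \<open>d\<close> being \<^const>\<open>dist\<close>.
  Quantities that may a priori be infinite are \<open>ennreal\<close>-valued.
\<close>

definition Prob :: "'a::topological_space measure set" where
  "Prob = {\<mu>. sets \<mu> = sets borel \<and> prob_space \<mu>}"

definition Prob1 :: "'a::metric_space measure set" where
  "Prob1 = {\<mu> \<in> Prob. \<exists>x0. (\<integral>\<^sup>+ x. ennreal (dist x0 x) \<partial>\<mu>) < \<infinity>}"

definition couplings :: "'a::topological_space measure \<Rightarrow> 'a measure \<Rightarrow> ('a \<times> 'a) measure set" where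
  "couplings \<mu> \<nu> = {\<pi> \<in> Prob. distr \<pi> borel fst = \<mu> \<and> distr \<pi> borel snd = \<nu>}"

definition W1 :: "'a::metric_space measure \<Rightarrow> 'a measure \<Rightarrow> ennreal" where
  "W1 \<mu> \<nu> = (INF \<pi>\<in>couplings \<mu> \<nu>. \<integral>\<^sup>+ p. ennreal (dist (fst p) (snd p)) \<partial>\<pi>)"

definition Z :: "'a measure \<Rightarrow> ('a \<Rightarrow> real) \<Rightarrow> ennreal" where
  "Z \<mu> \<Phi> = (\<integral>\<^sup>+ x. ennreal (exp (- \<Phi> x)) \<partial>\<mu>)"

text \<open>The measure \<open>\<mu>\<^sub>\<Phi>\<close>; only meaningful if \<open>0 < Z \<mu> \<Phi> < \<infinity>\<close>.\<close>

definition gibbs :: "'a measure \<Rightarrow> ('a \<Rightarrow> real) \<Rightarrow> 'a measure" where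
  "gibbs \<mu> \<Phi> = density \<mu> (\<lambda>x. ennreal (exp (- \<Phi> x)) / Z \<mu> \<Phi>)"

definition supp :: "'a::topological_space measure \<Rightarrow> 'a set" where
  "supp \<mu> = {x. \<forall>U. open U \<and> x \<in> U \<longrightarrow> 0 < emeasure \<mu> U}"

definition R :: "'a::metric_space measure \<Rightarrow> ennreal" where
  "R \<mu> = (SUP (x, y)\<in>supp \<mu> \<times> supp \<mu>. ennreal (dist x y))"

definition Lip_norm :: "'a::metric_space set \<Rightarrow> ('a \<Rightarrow> real) \<Rightarrow> ennreal" where
  "Lip_norm M f = (SUP (x, y)\<in>{(x, y). x \<in> M \<and> y \<in> M \<and> x \<noteq> y}. ennreal (\<bar>f x - f y\<bar> / dist x y))"

definition Lp_norm :: "real \<Rightarrow> 'a measure \<Rightarrow> ('a \<Rightarrow> real) \<Rightarrow> ennreal" where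
  "Lp_norm p \<mu> f =
     (let I = (\<integral>\<^sup>+ x. ennreal (\<bar>f x\<bar> powr p) \<partial>\<mu>)
      in if I = \<infinity> then \<infinity> else ennreal (enn2real I powr (1 / p)))"

definition Linf_norm :: "'a measure \<Rightarrow> ('a \<Rightarrow> real) \<Rightarrow> ennreal" where
  "Linf_norm \<mu> f = esssup \<mu> (\<lambda>x. ennreal \<bar>f x\<bar>)"

definition Lp :: "real \<Rightarrow> 'a measure \<Rightarrow> ('a \<Rightarrow> real) set" where
  "Lp p \<mu> = {f \<in> borel_measurable \<mu>. Lp_norm p \<mu> f < \<infinity>}"

definition Linf :: "'a measure \<Rightarrow> ('a \<Rightarrow> real) set" where
  "Linf \<mu> = {f \<in> borel_measurable \<mu>. Linf_norm \<mu> f < \<infinity>}"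

text \<open>Counterpart of the library's \<^const>\<open>esssup\<close>, which is a limes superior along the same filter.\<close>

definition essinf :: "'a measure \<Rightarrow> ('a \<Rightarrow> real) \<Rightarrow> ereal" where
  "essinf \<mu> f = Liminf (ae_filter \<mu>) (\<lambda>x. ereal (f x))"

end

(*
  Kantorovich-Rubinstein duality is reduced to finitely supported measures: a simple function T that is
  close to the identity in L^1 of both measures turns them into finitely supported ones, for which
  transport duality is a Hahn-Banach argument, and an optimal finite coupling w is spread out to a coupling of
  the original measures with density w(T x, T y) / (p(T x) q(T y)) with respect to the product measure.
  The supremum is attained since 1-Lipschitz functions vanishing at a point are compact under pointwise
  convergence, dominated by an integrable function. As
    \<integral> f (e^{-\<Phi>1} - e^{-\<Phi>2}) d\<mu> = Z1 \<integral> f d\<mu>_1 - Z2 \<integral> f d\<mu>_2,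
  the formula in (ii) is this duality. The upper bounds follow by normalising an optimal f to be at most R(\<mu>) on
  the support, the lower bounds by extending (e^{-\<Phi>1} - e^{-\<Phi>2}) / Lip from the support to a test function.
*)

theory Submission
  imports Defs "HOL-Complex_Analysis.Great_Picard"
begin

subsection \<open>Finite transport duality\<close>


text \<open>The obstacle is non-compactness: on a general Polish space a functional obtained from
  Hahn-Banach on bounded continuous functions need not come from a countably additive measure. On a
  finite set it is just a matrix of weights. The map T takes values in \<Theta> and is common to
  both measures, so both discretised measures live on the same finite set \<open>range T\<close>
  with cost \<open>dist\<close>, and the dual potentials found there extend to one 1-Lipschitz
  function on all of \<Theta>. Gluing by a density keeps the marginals exact, so the discretisation
  shows only in integrals of \<open>dist x (T x)\<close>. Couplings are near-optimal up to an error;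
  an exact optimiser is produced on the side of the functions. First moments do two jobs: they make
  the discretisation error small in L^1, and they dominate Lipschitz functions that vanish at a base
  point. The clause on non-equality rests on the normalisation: two functions with essential infimum
  0 cannot differ by a nonzero constant.\<close>

definition sublinear :: "(('i \<Rightarrow> real) \<Rightarrow> real) \<Rightarrow> bool" where
  "sublinear P \<longleftrightarrow> (\<forall>u v. P (\<lambda>i. u i + v i) \<le> P u + P v) \<and> (\<forall>c\<ge>0. \<forall>u. P (\<lambda>i. c * u i) \<le> c * P u)"

lemma sublinear_add: "sublinear P \<Longrightarrow> P (\<lambda>i. u i + v i) \<le> P u + P v"
  by (simp add: sublinear_def)

lemma sublinear_scale: "sublinear P \<Longrightarrow> 0 \<le> c \<Longrightarrow> P (\<lambda>i. c * u i) \<le> c * P u"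
  by (simp add: sublinear_def)

lemma sublinear_zero: "sublinear P \<Longrightarrow> P (\<lambda>i. 0) = 0"
  using sublinear_add[of P "\<lambda>i. 0" "\<lambda>i. 0"] sublinear_scale[of P 0 "\<lambda>i. 0"] by simp

lemma sublinear_neg: "sublinear P \<Longrightarrow> - P (\<lambda>i. - u i) \<le> P u"
  using sublinear_add[of P u "\<lambda>i. - u i"] sublinear_zero[of P] by simp

lemma sublinear_scale_eq:
  assumes P: "sublinear P" and c: "0 \<le> c"
  shows "P (\<lambda>i. c * u i) = c * P u"
proof (cases "c = 0")
  case True
  then show ?thesis using sublinear_zero[OF P] by simp
next
  case False
  with c have "c > 0" by simp
  have "P (\<lambda>i. inverse c * (c * u i)) \<le> inverse c * P (\<lambda>i. c * u i)"
    using c by (intro sublinear_scale[OF P]) simp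
  then have "c * P u \<le> P (\<lambda>i. c * u i)"
    using \<open>c > 0\<close> by (simp add: field_simps flip: mult.assoc)
  with sublinear_scale[OF P c, of u] show ?thesis by simp
qed

text \<open>The witness is the largest sublinear minorant of \<open>P\<close> that is linear along \<open>e\<close> and agrees with \<open>P\<close> at \<open>e\<close>.\<close>

lemma sublinear_linearize:
  assumes P: "sublinear P"
  obtains Q where "sublinear Q" "\<And>u. Q u \<le> P u" "Q (\<lambda>i. - e i) \<le> - P e"
proof
  define Q where "Q u = (INF t\<in>{0..}. P (\<lambda>i. u i + t * e i) - t * P e)" for u
  \<comment> \<open>Since \<open>t * P e\<close> is the value of \<open>P\<close> at t e,
    subadditivity gives a lower bound free of \<open>t\<close>; the infimum in \<open>Q\<close> is
    therefore finite.\<close>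
  have "- P (\<lambda>i. - u i) \<le> P (\<lambda>i. u i + t * e i) - t * P e" if "t \<ge> 0" for u t
    using sublinear_add[OF P, of "\<lambda>i. u i + t * e i" "\<lambda>i. - u i"] sublinear_scale_eq[OF P that, of e]
    by simp
  then have bdd: "bdd_below ((\<lambda>t. P (\<lambda>i. u i + t * e i) - t * P e) ` {0..})" for u
    by (intro bdd_belowI2) auto
  have le: "Q u \<le> P (\<lambda>i. u i + t * e i) - t * P e" if "t \<ge> 0" for u t
    unfolding Q_def using that by (intro cINF_lower[OF bdd]) auto
  have ge: "x \<le> Q u" if "\<And>t. t \<ge> 0 \<Longrightarrow> x \<le> P (\<lambda>i. u i + t * e i) - t * P e" for x u
    unfolding Q_def using that by (intro cINF_greatest) auto
  show "Q u \<le> P u" for u using le[of 0 u] by simp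
  show "Q (\<lambda>i. - e i) \<le> - P e" using le[of 1 "\<lambda>i. - e i"] sublinear_zero[OF P] by simp
  show "sublinear Q" unfolding sublinear_def
  proof (intro conjI allI impI)
    fix u v
    \<comment> \<open>The parameters add: s for u and t for v give the candidate s + t for u + v.
      Infima are then taken over t and over s in turn.\<close>
    have 1: "Q (\<lambda>i. u i + v i) - (P (\<lambda>i. u i + s * e i) - s * P e) \<le> P (\<lambda>i. v i + t * e i) - t * P e"
      if "s \<ge> 0" "t \<ge> 0" for s t
      using le[of "s + t" "\<lambda>i. u i + v i"] that
        sublinear_add[OF P, of "\<lambda>i. u i + s * e i" "\<lambda>i. v i + t * e i"]
      by (simp add: algebra_simps)
    have "Q (\<lambda>i. u i + v i) - (P (\<lambda>i. u i + s * e i) - s * P e) \<le> Q v" if "s \<ge> 0" for s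
      by (rule ge) (rule 1[OF that])
    then have "Q (\<lambda>i. u i + v i) - Q v \<le> Q u"
      by (intro ge) (simp add: algebra_simps)
    then show "Q (\<lambda>i. u i + v i) \<le> Q u + Q v" by simp
  next
    fix c :: real and u assume c: "c \<ge> 0"
    show "Q (\<lambda>i. c * u i) \<le> c * Q u"
    proof (cases "c = 0")
      case True
      then show ?thesis using le[of 0 "\<lambda>i. 0"] sublinear_zero[OF P] by simp
    next
      case False
      with c have c0: "c > 0" by simp
      have "Q (\<lambda>i. c * u i) / c \<le> Q u"
      proof (rule ge)
        fix t :: real assume t: "t \<ge> 0"
        have "Q (\<lambda>i. c * u i) \<le> P (\<lambda>i. c * (u i + t * e i)) - c * t * P e"
          using le[of "c * t" "\<lambda>i. c * u i"] t c by (simp add: algebra_simps)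
        also have "P (\<lambda>i. c * (u i + t * e i)) = c * P (\<lambda>i. u i + t * e i)"
          using c by (rule sublinear_scale_eq[OF P])
        finally show "Q (\<lambda>i. c * u i) / c \<le> P (\<lambda>i. u i + t * e i) - t * P e"
          using c0 by (simp add: field_simps)
      qed
      then show ?thesis using c0 by (simp add: field_simps)
    qed
  qed
qed

text \<open>Directions can be treated one at a time, because passing to a smaller sublinear
  functional keeps the linearity already gained: Q'(-x) \<le> Q(-x) \<le> -Q(x) \<le> -Q'(x). The
  opposite inequality is \<open>sublinear_neg\<close>, so the condition is indeed linearity along
  \<open>e\<close>.\<close>

lemma sublinear_linearize_finite:
  assumes "finite E" and P: "sublinear P"
  shows "\<exists>Q. sublinear Q \<and> (\<forall>u. Q u \<le> P u) \<and> (\<forall>e\<in>E. Q (\<lambda>i. - e i) \<le> - Q e)"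
  using assms(1)
proof induction
  case empty
  then show ?case using P by auto
next
  case (insert e E)
  then obtain Q where Q: "sublinear Q" "\<And>u. Q u \<le> P u" "\<And>e. e \<in> E \<Longrightarrow> Q (\<lambda>i. - e i) \<le> - Q e"
    by auto
  obtain Q' where Q': "sublinear Q'" "\<And>u. Q' u \<le> Q u" "Q' (\<lambda>i. - e i) \<le> - Q e"
    using sublinear_linearize[OF Q(1), of e] by metis
  have "Q' (\<lambda>i. - x i) \<le> - Q' x" if "x \<in> insert e E" for x
    using that Q'(3) Q'(2)[of x] Q'(2)[of "\<lambda>i. - x i"] Q(3)[of x] by fastforce
  then show ?case using Q Q' by (meson order_trans)
qed

text \<open>Linearising at \<open>u0\<close> first pins the value there: every later minorant is at
  most \<open>- P u0\<close> at the negative of \<open>u0\<close>. Linearising along the unit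
  vectors then leaves a functional that, on functions supported in \<open>I\<close>, is the sum with
  weights \<open>w i\<close>.\<close>

lemma hahn_banach_finite:
  fixes P :: "('i \<Rightarrow> real) \<Rightarrow> real"
  assumes I: "finite I" and P: "sublinear P" and u0: "\<And>i. i \<notin> I \<Longrightarrow> u0 i = 0"
  shows "\<exists>w. (\<forall>u. (\<forall>i. i \<notin> I \<longrightarrow> u i = 0) \<longrightarrow> (\<Sum>i\<in>I. w i * u i) \<le> P u) \<and>
    P u0 \<le> (\<Sum>i\<in>I. w i * u0 i)"
proof -
  obtain Q0 where Q0: "sublinear Q0" "\<And>u. Q0 u \<le> P u" "Q0 (\<lambda>i. - u0 i) \<le> - P u0"
    using sublinear_linearize[OF P, of u0] by metis
  define \<delta> :: "'i \<Rightarrow> 'i \<Rightarrow> real" where "\<delta> i = (\<lambda>j. if j = i then 1 else 0)" for i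
  obtain Q where Q: "sublinear Q" "\<And>u. Q u \<le> Q0 u" "\<And>i. i \<in> I \<Longrightarrow> Q (\<lambda>j. - \<delta> i j) \<le> - Q (\<delta> i)"
    using sublinear_linearize_finite[OF finite_imageI[OF I] Q0(1), of \<delta>] by auto
  define w where "w i = Q (\<delta> i)" for i
  \<comment> \<open>For nonnegative \<open>c\<close> homogeneity suffices; linearity along
    \<open>\<delta> i\<close> enters for negative \<open>c\<close>.\<close>
  have upper1: "Q (\<lambda>j. c * \<delta> i j) \<le> w i * c" if "i \<in> I" for c i
  proof (cases "c \<ge> 0")
    case True
    then show ?thesis using sublinear_scale[OF Q(1), of c "\<delta> i"] by (simp add: w_def mult.commute)
  next
    case False
    have "Q (\<lambda>j. (- c) * (- \<delta> i j)) \<le> (- c) * Q (\<lambda>j. - \<delta> i j)"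
      using False by (intro sublinear_scale[OF Q(1)]) simp
    also have "\<dots> \<le> (- c) * (- w i)"
      using Q(3)[OF that] False unfolding w_def by (intro mult_left_mono) auto
    finally show ?thesis by (simp add: mult.commute)
  qed
  have upper: "Q u \<le> (\<Sum>i\<in>J. w i * u i)"
    if "finite J" "J \<subseteq> I" "\<And>i. i \<notin> J \<Longrightarrow> u i = 0" for J u
    using that
  proof (induction J arbitrary: u)
    case empty
    then have "u = (\<lambda>i. 0)" by auto
    then show ?case using sublinear_zero[OF Q(1)] by simp
  next
    case (insert k J)
    have "u = (\<lambda>j. (u(k := 0)) j + u k * \<delta> k j)" by (auto simp: \<delta>_def)
    then have "Q u \<le> Q (u(k := 0)) + Q (\<lambda>j. u k * \<delta> k j)"
      using sublinear_add[OF Q(1)] by metis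
    also have "Q (u(k := 0)) \<le> (\<Sum>i\<in>J. w i * (u(k := 0)) i)"
      using insert.prems by (intro insert.IH) auto
    also have "(\<Sum>i\<in>J. w i * (u(k := 0)) i) = (\<Sum>i\<in>J. w i * u i)"
      using insert.hyps by (intro sum.cong) auto
    also have "Q (\<lambda>j. u k * \<delta> k j) \<le> w k * u k"
      using insert.prems by (intro upper1) auto
    finally show ?case using insert.hyps by simp
  qed
  \<comment> \<open>The upper bound at -u becomes a lower bound at u, as \<open>Q u\<close> is at
    least minus the value of \<open>Q\<close> at -u.\<close>
  have lower: "(\<Sum>i\<in>I. w i * u i) \<le> Q u" if "\<And>i. i \<notin> I \<Longrightarrow> u i = 0" for u
    using upper[OF I order_refl, of "\<lambda>i. - u i"] that sublinear_neg[OF Q(1), of u]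
    by (simp add: sum_negf)
  show ?thesis
  proof (intro exI conjI allI impI)
    show "(\<Sum>i\<in>I. w i * u i) \<le> P u" if "\<forall>i. i \<notin> I \<longrightarrow> u i = 0" for u
      using lower[of u] that Q(2)[of u] Q0(2)[of u] by fastforce
    show "P u0 \<le> (\<Sum>i\<in>I. w i * u0 i)"
      using lower[of "\<lambda>i. - u0 i"] u0 Q(2)[of "\<lambda>i. - u0 i"] Q0(3) by (simp add: sum_negf)
  qed
qed

lemma sum_mult_delta:
  fixes f :: "'a \<Rightarrow> 'b::semiring_0"
  assumes "finite I" "i \<in> I"
  shows "(\<Sum>k\<in>I. f k * (if k = i then s else 0)) = f i * s"
    and "(\<Sum>k\<in>I. (if k = i then s else 0) * f k) = s * f i"
proof -
  have "f k * (if k = i then s else 0) = (if k = i then f i * s else 0)"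
    "(if k = i then s else 0) * f k = (if k = i then s * f i else 0)" for k
    by auto
  then show "(\<Sum>k\<in>I. f k * (if k = i then s else 0)) = f i * s"
    "(\<Sum>k\<in>I. (if k = i then s else 0) * f k) = s * f i"
    using assms by simp_all
qed

section \<open>Transport duality for finite marginals\<close>

text \<open>Let \<open>P \<phi>\<close> be the infimum of the dual values of potentials whose sum
  dominates \<open>\<phi>\<close>. A linear minorant that touches \<open>P\<close> at -c is
  summation against a matrix \<open>w\<close>: testing it with simple functions forces nonnegativity
  and both marginals, and touching at -c is optimality. The infimum is only approached, hence the
  \<epsilon>.\<close>

lemma finite_transport_duality:
  fixes p :: "'a \<Rightarrow> real" and q :: "'b \<Rightarrow> real" and c :: "'a \<Rightarrow> 'b \<Rightarrow> real"
  assumes A: "finite A" and B: "finite B"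
    and p: "\<And>i. i \<in> A \<Longrightarrow> 0 \<le> p i" "sum p A = 1"
    and q: "\<And>j. j \<in> B \<Longrightarrow> 0 \<le> q j" "sum q B = 1"
  shows "\<exists>w. (\<forall>i\<in>A. \<forall>j\<in>B. 0 \<le> w i j) \<and> (\<forall>i\<in>A. (\<Sum>j\<in>B. w i j) = p i) \<and> (\<forall>j\<in>B. (\<Sum>i\<in>A. w i j) = q j) \<and>
    (\<forall>\<epsilon>>0. \<exists>f g. (\<forall>i\<in>A. \<forall>j\<in>B. f i + g j \<le> c i j) \<and>
       (\<Sum>i\<in>A. \<Sum>j\<in>B. w i j * c i j) \<le> (\<Sum>i\<in>A. f i * p i) + (\<Sum>j\<in>B. g j * q j) + \<epsilon>)"
proof -
  define D where "D \<phi> = {(f, g). \<forall>i\<in>A. \<forall>j\<in>B. \<phi> (i, j) \<le> f i + g j}" for \<phi> :: "'a \<times> 'b \<Rightarrow> real"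
  define V where "V = (\<lambda>(f, g). (\<Sum>i\<in>A. f i * p i) + (\<Sum>j\<in>B. g j * q j))"
  define P where "P \<phi> = (INF d\<in>D \<phi>. V d)" for \<phi>
  have ne: "D \<phi> \<noteq> {}" for \<phi>
  proof -
    have "bdd_above (\<phi> ` (A \<times> B))" using A B by simp
    then obtain M where "\<And>x. x \<in> A \<times> B \<Longrightarrow> \<phi> x \<le> M" by (auto simp: bdd_above_def)
    then have "(\<lambda>_. M, \<lambda>_. 0) \<in> D \<phi>" by (auto simp: D_def)
    then show ?thesis by auto
  qed
  \<comment> \<open>The product matrix \<open>p i * q j\<close> is one admissible plan, and its
    value bounds every dual value from below; the total masses 1 enter here. This keeps the infimum
    in \<open>P\<close> finite.\<close>
  have lb: "(\<Sum>i\<in>A. \<Sum>j\<in>B. p i * q j * \<phi> (i, j)) \<le> V d" if "d \<in> D \<phi>" for \<phi> d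
  proof -
    obtain f g where d: "d = (f, g)" by force
    have "(\<Sum>i\<in>A. \<Sum>j\<in>B. p i * q j * \<phi> (i, j)) \<le> (\<Sum>i\<in>A. \<Sum>j\<in>B. p i * q j * (f i + g j))"
      using that p(1) q(1) unfolding D_def d by (intro sum_mono mult_left_mono) auto
    also have "\<dots> = (\<Sum>i\<in>A. f i * p i * sum q B) + sum p A * (\<Sum>j\<in>B. g j * q j)"
      using sum.swap[of "\<lambda>i j. g j * (p i * q j)" B A]
      by (simp add: algebra_simps sum.distrib sum_distrib_left sum_distrib_right)
    also have "\<dots> = V d" using p(2) q(2) by (simp add: V_def d)
    finally show ?thesis .
  qed
  have bdd: "bdd_below (V ` D \<phi>)" for \<phi> using lb by (intro bdd_belowI2)
  have le: "P \<phi> \<le> V d" if "d \<in> D \<phi>" for \<phi> d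
    unfolding P_def using that by (rule cINF_lower[OF bdd])
  have ge: "x \<le> P \<phi>" if "\<And>d. d \<in> D \<phi> \<Longrightarrow> x \<le> V d" for \<phi> x
    unfolding P_def using that by (rule cINF_greatest[OF ne])
  have P: "sublinear P" unfolding sublinear_def
  proof (intro conjI allI impI)
    fix u v
    have *: "P (\<lambda>i. u i + v i) - V d \<le> V d'" if dd: "d \<in> D u" "d' \<in> D v" for d d'
    proof -
      obtain f g f' g' where d: "d = (f, g)" "d' = (f', g')" by force
      have "P (\<lambda>i. u i + v i) \<le> V (\<lambda>i. f i + f' i, \<lambda>i. g i + g' i)"
        using dd unfolding d D_def by (intro le) (fastforce simp: D_def)
      then show ?thesis by (simp add: V_def d algebra_simps sum.distrib)
    qed
    have "P (\<lambda>i. u i + v i) - P v \<le> V d" if "d \<in> D u" for d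
      using ge[of v, OF *[OF that]] by simp
    then show "P (\<lambda>i. u i + v i) \<le> P u + P v"
      using ge[of u "P (\<lambda>i. u i + v i) - P v"] by simp
  next
    fix c :: real and u assume c: "c \<ge> 0"
    have *: "P (\<lambda>i. c * u i) \<le> c * V d" if dd: "d \<in> D u" for d
    proof -
      obtain f g where d: "d = (f, g)" by force
      have "P (\<lambda>i. c * u i) \<le> V (\<lambda>i. c * f i, \<lambda>i. c * g i)"
        using dd c unfolding d D_def
        by (intro le) (auto simp: D_def simp flip: distrib_left intro!: mult_left_mono)
      then show ?thesis by (simp add: V_def d algebra_simps sum_distrib_left)
    qed
    show "P (\<lambda>i. c * u i) \<le> c * P u"
    proof (cases "c = 0")
      case True
      then show ?thesis using * ne[of u] by fastforce
    next
      case False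
      then have "P (\<lambda>i. c * u i) / c \<le> P u" using * c
        by (intro ge) (simp add: field_simps)
      then show ?thesis using False c by (simp add: field_simps)
    qed
  qed
  \<comment> \<open>The cost enters negated because pairs in \<open>D\<close> lie above their
    argument; negating them at the end puts the potentials below \<open>c\<close>. The value 0
    elsewhere keeps \<open>c0\<close> supported on the finite set
    \<open>A \<times> B\<close>.\<close>
  define c0 where "c0 = (\<lambda>(i, j). if i \<in> A \<and> j \<in> B then - c i j else 0)"
  have c0_zero: "c0 x = 0" if "x \<notin> A \<times> B" for x
    using that by (cases x) (auto simp: c0_def)
  have "\<exists>w. (\<forall>u. (\<forall>i. i \<notin> A \<times> B \<longrightarrow> u i = 0) \<longrightarrow> (\<Sum>i\<in>A \<times> B. w i * u i) \<le> P u) \<and>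
      P c0 \<le> (\<Sum>i\<in>A \<times> B. w i * c0 i)"
    by (intro hahn_banach_finite finite_cartesian_product A B P c0_zero)
  then obtain w where w: "\<forall>u. (\<forall>i. i \<notin> A \<times> B \<longrightarrow> u i = 0) \<longrightarrow> (\<Sum>i\<in>A \<times> B. w i * u i) \<le> P u"
    and w0: "P c0 \<le> (\<Sum>i\<in>A \<times> B. w i * c0 i)"
    by (elim exE conjE) (rule that)
  have test: "(\<Sum>i\<in>A. \<Sum>j\<in>B. w (i, j) * u i j) \<le> (\<Sum>i\<in>A. f i * p i) + (\<Sum>j\<in>B. g j * q j)"
    if "\<And>i j. i \<in> A \<Longrightarrow> j \<in> B \<Longrightarrow> u i j \<le> f i + g j" for u f g
  proof -
    define u' where "u' = (\<lambda>(i, j). if i \<in> A \<and> j \<in> B then u i j else 0)"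
    have "(\<Sum>i\<in>A. \<Sum>j\<in>B. w (i, j) * u i j) = (\<Sum>i\<in>A \<times> B. w i * u' i)"
      by (auto simp: sum.cartesian_product u'_def intro!: sum.cong)
    also have "\<dots> \<le> P u'"
    proof (rule w[rule_format])
      show "u' x = 0" if "x \<notin> A \<times> B" for x using that by (cases x) (auto simp: u'_def)
    qed
    also have "\<dots> \<le> V (f, g)" using that by (intro le) (auto simp: D_def u'_def)
    finally show ?thesis by (simp add: V_def)
  qed
  show ?thesis
  proof (intro exI[of _ "\<lambda>i j. w (i, j)"] conjI ballI allI impI)
    fix i j assume ij: "i \<in> A" "j \<in> B"
    \<comment> \<open>Test function: minus the indicator of (i, j), dominated by zero
      potentials.\<close>
    have "(\<Sum>i'\<in>A. \<Sum>j'\<in>B. w (i', j') * (if i' = i then if j' = j then -1 else 0 else 0)) \<le> 0"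
      using test[of "\<lambda>i' j'. if i' = i then if j' = j then -1 else 0 else 0" "\<lambda>_. 0" "\<lambda>_. 0"] by auto
    also have "(\<Sum>i'\<in>A. \<Sum>j'\<in>B. w (i', j') * (if i' = i then if j' = j then -1 else 0 else 0))
        = (\<Sum>i'\<in>A. if i' = i then - w (i, j) else 0)"
      by (intro sum.cong) (auto simp: sum_mult_delta[OF B ij(2)])
    finally show "0 \<le> w (i, j)" using ij A by simp
  next
    fix i assume i: "i \<in> A"
    have *: "(\<Sum>i'\<in>A. \<Sum>j'\<in>B. w (i', j') * (if i' = i then s else 0)) = s * (\<Sum>j\<in>B. w (i, j))" for s
    proof -
      have "(\<Sum>i'\<in>A. \<Sum>j'\<in>B. w (i', j') * (if i' = i then s else 0))
          = (\<Sum>i'\<in>A. if i' = i then s * (\<Sum>j\<in>B. w (i, j)) else 0)"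
        by (intro sum.cong) (auto simp: sum_distrib_left mult.commute)
      then show ?thesis using A i by simp
    qed
    \<comment> \<open>The signs s = 1 and s = -1 together turn the inequality into the marginal
      equation.\<close>
    have "s * (\<Sum>j\<in>B. w (i, j)) \<le> s * p i" for s
      using test[of "\<lambda>i' j'. if i' = i then s else 0" "\<lambda>i'. if i' = i then s else 0" "\<lambda>_. 0"]
      unfolding * by (auto simp: sum_mult_delta[OF A i])
    from this[of 1] this[of "-1"] show "(\<Sum>j\<in>B. w (i, j)) = p i" by simp
  next
    fix j assume j: "j \<in> B"
    have *: "(\<Sum>i'\<in>A. \<Sum>j'\<in>B. w (i', j') * (if j' = j then s else 0)) = s * (\<Sum>i\<in>A. w (i, j))" for s
      by (simp add: sum_mult_delta[OF B j] sum_distrib_left mult.commute)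
    have "s * (\<Sum>i\<in>A. w (i, j)) \<le> s * q j" for s
      using test[of "\<lambda>i' j'. if j' = j then s else 0" "\<lambda>_. 0" "\<lambda>i'. if i' = j then s else 0"]
      unfolding * by (auto simp: sum_mult_delta[OF B j])
    from this[of 1] this[of "-1"] show "(\<Sum>i\<in>A. w (i, j)) = q j" by simp
  next
    fix \<epsilon> :: real assume "0 < \<epsilon>"
    then have "P c0 < P c0 + \<epsilon>" by simp
    then obtain d where d: "d \<in> D c0" "V d < P c0 + \<epsilon>"
      unfolding P_def using cINF_less_iff[OF ne bdd] by metis
    obtain f g where fg: "d = (f, g)" by force
    have "V d < (\<Sum>i\<in>A \<times> B. w i * c0 i) + \<epsilon>" using d(2) w0 by simp
    also have "(\<Sum>i\<in>A \<times> B. w i * c0 i) = (\<Sum>i\<in>A. \<Sum>j\<in>B. - (w (i, j) * c i j))"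
      unfolding sum.cartesian_product by (auto simp: c0_def intro!: sum.cong)
    finally have "(\<Sum>i\<in>A. \<Sum>j\<in>B. w (i, j) * c i j)
        \<le> (\<Sum>i\<in>A. - f i * p i) + (\<Sum>j\<in>B. - g j * q j) + \<epsilon>"
      by (simp add: V_def fg sum_negf)
    moreover have "\<forall>i\<in>A. \<forall>j\<in>B. - f i + - g j \<le> c i j"
      using d(1) by (fastforce simp: D_def fg c0_def)
    ultimately show "\<exists>f g. (\<forall>i\<in>A. \<forall>j\<in>B. f i + g j \<le> c i j) \<and>
       (\<Sum>i\<in>A. \<Sum>j\<in>B. w (i, j) * c i j) \<le> (\<Sum>i\<in>A. f i * p i) + (\<Sum>j\<in>B. g j * q j) + \<epsilon>"
      by (intro exI[of _ "\<lambda>i. - f i"] exI[of _ "\<lambda>i. - g i"]) simp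
  qed
qed

subsection \<open>Couplings\<close>


lemma Prob_sets [measurable_cong]: "\<mu> \<in> Prob \<Longrightarrow> sets \<mu> = sets borel"
  by (simp add: Prob_def)

lemma Prob_prob_space: "\<mu> \<in> Prob \<Longrightarrow> prob_space \<mu>"
  by (simp add: Prob_def)

lemma Prob_space: "\<mu> \<in> Prob \<Longrightarrow> space \<mu> = UNIV"
  using sets_eq_imp_space_eq[OF Prob_sets] by simp

lemma Prob_measurable: "\<mu> \<in> Prob \<Longrightarrow> measurable \<mu> N = measurable borel N"
  by (intro measurable_cong_sets) (auto simp: Prob_sets)

lemma Prob1_Prob: "\<mu> \<in> Prob1 \<Longrightarrow> \<mu> \<in> Prob"
  by (simp add: Prob1_def)

lemma Lip_norm_le_iff:
  assumes "0 \<le> L"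
  shows "Lip_norm M f \<le> ennreal L \<longleftrightarrow> (\<forall>x\<in>M. \<forall>y\<in>M. \<bar>f x - f y\<bar> \<le> L * dist x y)"
proof -
  have "\<bar>f x - f y\<bar> / dist x y \<le> L \<longleftrightarrow> \<bar>f x - f y\<bar> \<le> L * dist x y" if "x \<noteq> y" for x y
    using that by (simp add: field_simps)
  then have *: "ennreal (\<bar>f x - f y\<bar> / dist x y) \<le> ennreal L \<longleftrightarrow> \<bar>f x - f y\<bar> \<le> L * dist x y"
    if "x \<noteq> y" for x y using that assms by (simp add: ennreal_le_iff)
  show ?thesis unfolding Lip_norm_def SUP_le_iff using *
    by (auto simp: Ball_def) (metis abs_zero diff_self dist_self mult_zero_right order_refl)
qed

lemma Lip_norm_le_1_iff: "Lip_norm UNIV f \<le> 1 \<longleftrightarrow> (\<forall>x y. \<bar>f x - f y\<bar> \<le> dist x y)"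
  using Lip_norm_le_iff[of 1 UNIV f] by simp

lemma Lip_le_1_measurable:
  fixes f :: "'a::metric_space \<Rightarrow> real"
  assumes "Lip_norm UNIV f \<le> 1"
  shows "f \<in> borel_measurable borel"
proof (rule borel_measurable_continuous_onI)
  have "1-lipschitz_on UNIV f"
    using assms by (intro lipschitz_onI) (auto simp: Lip_norm_le_1_iff dist_real_def)
  then show "continuous_on UNIV f" by (rule lipschitz_on_continuous_on)
qed

lemma Prob1_integrable_dist:
  assumes "\<mu> \<in> Prob1"
  shows "integrable \<mu> (dist z)"
proof -
  interpret prob_space \<mu> using assms by (intro Prob_prob_space Prob1_Prob)
  have m[measurable]: "dist a \<in> borel_measurable \<mu>" for a
    unfolding Prob_measurable[OF Prob1_Prob[OF assms]]
    by (intro borel_measurable_continuous_onI continuous_intros)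
  obtain x0 where "(\<integral>\<^sup>+ x. ennreal (dist x0 x) \<partial>\<mu>) < \<infinity>"
    using assms by (auto simp: Prob1_def)
  then have "integrable \<mu> (\<lambda>x. dist z x0 + dist x0 x)"
    by (intro Bochner_Integration.integrable_add integrable_const integrableI_nonneg) auto
  then show ?thesis
    by (rule Bochner_Integration.integrable_bound) (auto intro: dist_triangle)
qed

lemma Prob1_integrable_Lip:
  assumes "\<mu> \<in> Prob1" "Lip_norm UNIV f \<le> 1"
  shows "integrable \<mu> f"
proof -
  interpret prob_space \<mu> using assms by (intro Prob_prob_space Prob1_Prob)
  fix z :: 'a
  have "integrable \<mu> (\<lambda>x. \<bar>f z\<bar> + dist z x)"
    using Prob1_integrable_dist[OF assms(1)] by simp
  then show ?thesis
  proof (rule Bochner_Integration.integrable_bound)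
    show "f \<in> borel_measurable \<mu>"
      using Lip_le_1_measurable[OF assms(2)] by (simp add: Prob_measurable[OF Prob1_Prob[OF assms(1)]])
    have "\<bar>f x\<bar> \<le> \<bar>f z\<bar> + dist z x" for x
      using assms(2)[unfolded Lip_norm_le_1_iff, rule_format, of z x] by simp
    then show "AE x in \<mu>. norm (f x) \<le> norm (\<bar>f z\<bar> + dist z x)" by auto
  qed
qed

text \<open>The easy half of duality: both integrals are moved to the coupling, where the integrand
  f(x) - f(y) is at most the distance. First moments make \<open>f\<close> integrable, so that the
  difference of integrals is the integral of the difference.\<close>

lemma coupling_cost_ge:
  fixes \<mu> \<nu> :: "'a::polish_space measure"
  assumes \<mu>: "\<mu> \<in> Prob1" and \<nu>: "\<nu> \<in> Prob1" and f: "Lip_norm UNIV f \<le> 1"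
    and \<pi>: "\<pi> \<in> couplings \<mu> \<nu>"
  shows "ennreal \<bar>(\<integral>x. f x \<partial>\<mu>) - (\<integral>x. f x \<partial>\<nu>)\<bar> \<le> (\<integral>\<^sup>+ p. ennreal (dist (fst p) (snd p)) \<partial>\<pi>)"
proof -
  have [measurable_cong]: "sets \<pi> = sets borel" and d: "distr \<pi> borel fst = \<mu>" "distr \<pi> borel snd = \<nu>"
    using \<pi> by (auto simp: couplings_def Prob_def)
  have [measurable]: "fst \<in> \<pi> \<rightarrow>\<^sub>M (borel :: 'a measure)" "snd \<in> \<pi> \<rightarrow>\<^sub>M (borel :: 'a measure)"
    "f \<in> borel_measurable borel"
    using Lip_le_1_measurable[OF f]
    by (auto simp: borel_prod[symmetric] measurable_cong_sets[OF \<open>sets \<pi> = sets borel\<close> refl])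
  have i: "integrable \<pi> (\<lambda>p. f (fst p))" "integrable \<pi> (\<lambda>p. f (snd p))"
    using Prob1_integrable_Lip[OF \<mu> f] Prob1_integrable_Lip[OF \<nu> f]
    unfolding d[symmetric] by (auto simp: integrable_distr_eq)
  have "(\<integral>x. f x \<partial>\<mu>) - (\<integral>x. f x \<partial>\<nu>) = (\<integral>p. f (fst p) - f (snd p) \<partial>\<pi>)"
    unfolding d[symmetric] using i by (simp add: integral_distr)
  then have "ennreal \<bar>(\<integral>x. f x \<partial>\<mu>) - (\<integral>x. f x \<partial>\<nu>)\<bar> \<le> (\<integral>\<^sup>+ p. ennreal (norm (f (fst p) - f (snd p))) \<partial>\<pi>)"
    using integral_norm_bound_ennreal[of \<pi> "\<lambda>p. f (fst p) - f (snd p)"] i by simp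
  also have "\<dots> \<le> (\<integral>\<^sup>+ p. ennreal (dist (fst p) (snd p)) \<partial>\<pi>)"
    using f by (intro nn_integral_mono) (auto simp: Lip_norm_le_1_iff intro!: ennreal_leI)
  finally show ?thesis .
qed

section \<open>Discretisation, and couplings built from finite ones\<close>

text \<open>Simple functions converging pointwise to the identity also converge in L^1 of either
  measure, by dominated convergence against the first moment. Both integrals are eventually small,
  so one index serves both measures.\<close>

lemma simple_approximation:
  fixes \<mu> \<nu> :: "'a::polish_space measure"
  assumes \<mu>: "\<mu> \<in> Prob1" and \<nu>: "\<nu> \<in> Prob1" and \<epsilon>: "\<epsilon> > 0"
  obtains T where "simple_function borel T"
    "integrable \<mu> (\<lambda>x. dist x (T x))" "(\<integral>x. dist x (T x) \<partial>\<mu>) < \<epsilon>"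
    "integrable \<nu> (\<lambda>x. dist x (T x))" "(\<integral>x. dist x (T x) \<partial>\<nu>) < \<epsilon>"
proof -
  fix z :: 'a
  obtain F where F: "\<And>i. simple_function borel (F i)" "\<And>x. (\<lambda>i. F i x) \<longlonglongrightarrow> x"
    "\<And>i x. dist (F i x) z \<le> 2 * dist x z"
    using borel_measurable_implies_sequence_metric[of "\<lambda>x. x" "borel :: 'a measure" z] by auto
  have [measurable]: "F i \<in> borel_measurable borel" for i
    by (rule borel_measurable_simple_function[OF F(1)])
  have *: "integrable M (\<lambda>x. dist x (F i x))" "(\<lambda>i. \<integral>x. dist x (F i x) \<partial>M) \<longlonglongrightarrow> 0"
    if M: "M \<in> Prob1" for M i
  proof -
    note [measurable_cong] = Prob_sets[OF Prob1_Prob[OF M]]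
    \<comment> \<open>The constant is 1 + 2: the distance of x to z plus that of
      \<open>F i x\<close> to z, which is at most twice the former.\<close>
    have b: "norm (dist x (F i x)) \<le> 3 * dist z x" for i x
      using dist_triangle2[of x "F i x" z] F(3)[of i x] by (simp add: dist_commute)
    have int: "integrable M (\<lambda>x. 3 * dist z x)"
      using Prob1_integrable_dist[OF M] by simp
    have m: "(\<lambda>x. dist x (F i x)) \<in> borel_measurable M" for i
      unfolding Prob_measurable[OF Prob1_Prob[OF M]] by measurable
    show "integrable M (\<lambda>x. dist x (F i x))"
      by (rule Bochner_Integration.integrable_bound[OF int m]) (use b in \<open>auto intro: order_trans\<close>)
    have "(\<lambda>i. \<integral>x. dist x (F i x) \<partial>M) \<longlonglongrightarrow> (\<integral>x. 0 \<partial>M)"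
    proof (rule integral_dominated_convergence[OF _ _ int])
      have "(\<lambda>i. dist x (F i x)) \<longlonglongrightarrow> dist x x" for x
        by (intro tendsto_intros F)
      then show "AE x in M. (\<lambda>i. dist x (F i x)) \<longlonglongrightarrow> 0" by simp
    qed (use b m in auto)
    then show "(\<lambda>i. \<integral>x. dist x (F i x) \<partial>M) \<longlonglongrightarrow> 0" by simp
  qed
  have "\<forall>\<^sub>F i in sequentially. (\<integral>x. dist x (F i x) \<partial>\<mu>) < \<epsilon> \<and> (\<integral>x. dist x (F i x) \<partial>\<nu>) < \<epsilon>"
    using *(2)[OF \<mu>] *(2)[OF \<nu>] \<epsilon> by (intro eventually_conj order_tendstoD)
  then obtain i where "(\<integral>x. dist x (F i x) \<partial>\<mu>) < \<epsilon>" "(\<integral>x. dist x (F i x) \<partial>\<nu>) < \<epsilon>"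
    by (auto simp: eventually_sequentially)
  then show thesis using that F(1) *(1)[OF \<mu>] *(1)[OF \<nu>] by blast
qed

lemma nn_integral_compose_simple:
  fixes G :: "'b \<Rightarrow> ennreal"
  assumes T: "simple_function M T"
  shows "(\<integral>\<^sup>+ x. G (T x) \<partial>M) = (\<Sum>i\<in>T ` space M. G i * emeasure M (T -` {i} \<inter> space M))"
proof -
  have fin: "finite (T ` space M)" and [measurable]: "\<And>i. i \<in> T ` space M \<Longrightarrow> T -` {i} \<inter> space M \<in> sets M"
    using T by (auto simp: simple_function_def)
  have "(\<integral>\<^sup>+ x. G (T x) \<partial>M) = (\<integral>\<^sup>+ x. (\<Sum>i\<in>T ` space M. G i * indicator (T -` {i} \<inter> space M) x) \<partial>M)"
  proof (rule nn_integral_cong)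
    fix x assume x: "x \<in> space M"
    have "(\<Sum>i\<in>T ` space M. G i * indicator (T -` {i} \<inter> space M) x) = (\<Sum>i\<in>T ` space M. if T x = i then G i else 0)"
      using x by (intro sum.cong) (auto simp: indicator_def)
    then show "G (T x) = (\<Sum>i\<in>T ` space M. G i * indicator (T -` {i} \<inter> space M) x)"
      using x fin by (simp add: sum.delta)
  qed
  also have "\<dots> = (\<Sum>i\<in>T ` space M. G i * emeasure M (T -` {i} \<inter> space M))"
    by (subst nn_integral_sum) (auto simp: nn_integral_cmult_indicator)
  finally show ?thesis .
qed

text \<open>Fubini reads off both marginals. The normalisations are almost everywhere conditions
  because the density used for gluing violates them on cells of measure zero.\<close>

lemma coupling_density:
  fixes \<mu> \<nu> :: "'a::polish_space measure"
  assumes \<mu>: "\<mu> \<in> Prob" and \<nu>: "\<nu> \<in> Prob" and g: "g \<in> borel_measurable borel"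
    and g1: "AE x in \<mu>. (\<integral>\<^sup>+ y. g (x, y) \<partial>\<nu>) = 1"
    and g2: "AE y in \<nu>. (\<integral>\<^sup>+ x. g (x, y) \<partial>\<mu>) = 1"
  shows "density (\<mu> \<Otimes>\<^sub>M \<nu>) g \<in> couplings \<mu> \<nu>"
proof -
  interpret M: prob_space \<mu> by (rule Prob_prob_space[OF \<mu>])
  interpret N: prob_space \<nu> by (rule Prob_prob_space[OF \<nu>])
  interpret pair_sigma_finite \<mu> \<nu> ..
  note [measurable_cong] = Prob_sets[OF \<mu>] Prob_sets[OF \<nu>]
  note [simp] = Prob_space[OF \<mu>] Prob_space[OF \<nu>]
  have sets: "sets (\<mu> \<Otimes>\<^sub>M \<nu>) = sets borel"
    using sets_pair_measure_cong[OF Prob_sets[OF \<mu>] Prob_sets[OF \<nu>]] unfolding borel_prod .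
  have g'[measurable]: "g \<in> borel_measurable (\<mu> \<Otimes>\<^sub>M \<nu>)"
    using g by (simp add: measurable_cong_sets[OF sets refl])
  define \<pi> where "\<pi> = density (\<mu> \<Otimes>\<^sub>M \<nu>) g"
  have fs[measurable]: "fst \<in> \<pi> \<rightarrow>\<^sub>M (borel::'a measure)" "snd \<in> \<pi> \<rightarrow>\<^sub>M (borel::'a measure)"
    unfolding \<pi>_def by (auto simp: measurable_cong_sets[OF sets refl] borel_prod[symmetric])
  have 1: "distr \<pi> borel fst = \<mu>"
  proof (rule measure_eqI)
    fix A assume "A \<in> sets (distr \<pi> borel fst)"
    then have A[measurable]: "A \<in> sets borel" by simp
    then have A'[measurable]: "A \<in> sets \<mu>" using Prob_sets[OF \<mu>] by simp
    have [measurable]: "A \<times> UNIV \<in> sets (\<mu> \<Otimes>\<^sub>M \<nu>)"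
      using A Prob_sets[OF \<mu>] Prob_sets[OF \<nu>] by (intro pair_measureI) auto
    have "emeasure (distr \<pi> borel fst) A = emeasure \<pi> (A \<times> UNIV)"
      unfolding emeasure_distr[OF fs(1) A]
      by (intro arg_cong2[where f=emeasure]) (auto simp: \<pi>_def space_pair_measure)
    also have "\<dots> = (\<integral>\<^sup>+ z. g z * indicator (A \<times> UNIV) z \<partial>(\<mu> \<Otimes>\<^sub>M \<nu>))"
      unfolding \<pi>_def by (intro emeasure_density) measurable
    also have "\<dots> = (\<integral>\<^sup>+ x. \<integral>\<^sup>+ y. g (x, y) * indicator (A \<times> UNIV) (x, y) \<partial>\<nu> \<partial>\<mu>)"
      by (subst N.nn_integral_fst[symmetric]) measurable
    also have "\<dots> = (\<integral>\<^sup>+ x. (\<integral>\<^sup>+ y. g (x, y) \<partial>\<nu>) * indicator A x \<partial>\<mu>)"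
      by (intro nn_integral_cong) (auto simp: indicator_def)
    also have "\<dots> = (\<integral>\<^sup>+ x. indicator A x \<partial>\<mu>)"
      using g1 by (intro nn_integral_cong_AE) auto
    finally show "emeasure (distr \<pi> borel fst) A = emeasure \<mu> A" by simp
  qed (simp add: Prob_sets[OF \<mu>])
  have 2: "distr \<pi> borel snd = \<nu>"
  proof (rule measure_eqI)
    fix A assume "A \<in> sets (distr \<pi> borel snd)"
    then have A[measurable]: "A \<in> sets borel" by simp
    then have A'[measurable]: "A \<in> sets \<nu>" using Prob_sets[OF \<nu>] by simp
    have [measurable]: "UNIV \<times> A \<in> sets (\<mu> \<Otimes>\<^sub>M \<nu>)"
      using A Prob_sets[OF \<mu>] Prob_sets[OF \<nu>] by (intro pair_measureI) auto
    have "emeasure (distr \<pi> borel snd) A = emeasure \<pi> (UNIV \<times> A)"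
      unfolding emeasure_distr[OF fs(2) A]
      by (intro arg_cong2[where f=emeasure]) (auto simp: \<pi>_def space_pair_measure)
    also have "\<dots> = (\<integral>\<^sup>+ z. g z * indicator (UNIV \<times> A) z \<partial>(\<mu> \<Otimes>\<^sub>M \<nu>))"
      unfolding \<pi>_def by (intro emeasure_density) measurable
    also have "\<dots> = (\<integral>\<^sup>+ y. \<integral>\<^sup>+ x. g (x, y) * indicator (UNIV \<times> A) (x, y) \<partial>\<mu> \<partial>\<nu>)"
      by (subst nn_integral_snd[symmetric]) measurable
    also have "\<dots> = (\<integral>\<^sup>+ y. (\<integral>\<^sup>+ x. g (x, y) \<partial>\<mu>) * indicator A y \<partial>\<nu>)"
      by (intro nn_integral_cong) (auto simp: indicator_def)
    also have "\<dots> = (\<integral>\<^sup>+ y. indicator A y \<partial>\<nu>)"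
      using g2 by (intro nn_integral_cong_AE) auto
    finally show "emeasure (distr \<pi> borel snd) A = emeasure \<nu> A" by simp
  qed (simp add: Prob_sets[OF \<nu>])
  have "prob_space \<pi>"
  proof (rule prob_spaceI)
    have "emeasure \<mu> UNIV = emeasure (distr \<pi> borel fst) UNIV" by (simp add: 1)
    also have "\<dots> = emeasure \<pi> (space \<pi>)" by (subst emeasure_distr) auto
    finally show "emeasure \<pi> (space \<pi>) = 1" using M.emeasure_space_1 by simp
  qed
  then show ?thesis using 1 2 sets by (simp add: couplings_def Prob_def \<pi>_def)
qed

text \<open>On the product of the cells of \<open>i\<close> and \<open>j\<close> the mass
  \<open>w i j\<close> is spread proportionally to the product measure. This gives exact marginals
  \<mu> and \<nu>, and the cost between the images under \<open>T\<close> is the finite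
  cost.\<close>

lemma glue_finite_coupling:
  fixes \<mu> \<nu> :: "'a::polish_space measure" and T :: "'a \<Rightarrow> 'a"
  assumes \<mu>: "\<mu> \<in> Prob" and \<nu>: "\<nu> \<in> Prob" and T: "simple_function borel T"
    and w0: "\<forall>i\<in>range T. \<forall>j\<in>range T. 0 \<le> w i j"
    and w1: "\<forall>i\<in>range T. (\<Sum>j\<in>range T. w i j) = measure \<mu> (T -` {i})"
    and w2: "\<forall>j\<in>range T. (\<Sum>i\<in>range T. w i j) = measure \<nu> (T -` {j})"
  shows "\<exists>\<pi>\<in>couplings \<mu> \<nu>. (\<integral>\<^sup>+ z. ennreal (dist (T (fst z)) (T (snd z))) \<partial>\<pi>)
       = ennreal (\<Sum>i\<in>range T. \<Sum>j\<in>range T. w i j * dist i j)"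
proof -
  interpret M: prob_space \<mu> by (rule Prob_prob_space[OF \<mu>])
  interpret N: prob_space \<nu> by (rule Prob_prob_space[OF \<nu>])
  note [measurable_cong] = Prob_sets[OF \<mu>] Prob_sets[OF \<nu>]
  note [simp] = Prob_space[OF \<mu>] Prob_space[OF \<nu>]
  define p where "p i = measure \<mu> (T -` {i})" for i
  define q where "q i = measure \<nu> (T -` {i})" for i
  let ?S = "range T"
  have fin[simp]: "finite ?S" and Ti: "\<And>i. T -` {i} \<in> sets borel"
  proof -
    show "finite ?S" using T by (simp add: simple_function_def)
    show "T -` {i} \<in> sets borel" for i
    proof (cases "i \<in> ?S")
      case True
      then show ?thesis using T by (auto simp: simple_function_def)
    next
      case False
      then have "T -` {i} = {}" by auto
      then show ?thesis by simp
    qed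
  qed
  have T\<mu>: "simple_function \<mu> T" and T\<nu>: "simple_function \<nu> T"
    using T Prob_sets[OF \<mu>] Prob_sets[OF \<nu>] by (auto simp: simple_function_def)
  \<comment> \<open>Nonnegative entries in a row with sum 0 vanish. Together with \<open>wq\<close>
    this makes the convention x / 0 = 0 harmless in \<open>G\<close>.\<close>
  have wp: "w i j = 0" if "i \<in> ?S" "j \<in> ?S" "p i = 0" for i j
    using w1 that w0 sum_nonneg_eq_0_iff[OF fin, of "w i"] unfolding p_def
    by (metis (mono_tags, lifting))
  have wq: "w i j = 0" if "i \<in> ?S" "j \<in> ?S" "q j = 0" for i j
    using w2 that w0 sum_nonneg_eq_0_iff[OF fin, of "\<lambda>i. w i j"] unfolding q_def
    by (metis (mono_tags, lifting))
  define G where "G i j = ennreal (w i j / (p i * q j))" for i j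
  \<comment> \<open>\<open>H\<close> is arbitrary; measurability comes from writing the composition
    as a finite sum over indicators of products of cells.\<close>
  have meas: "(\<lambda>z. H (T (fst z)) (T (snd z))) \<in> borel_measurable borel" for H :: "'a \<Rightarrow> 'a \<Rightarrow> ennreal"
  proof -
    have [measurable]: "T -` {i} \<in> sets borel" for i by (rule Ti)
    have "(\<lambda>z. \<Sum>i\<in>?S. \<Sum>j\<in>?S. H i j * indicator (T -` {i}) (fst z) * indicator (T -` {j}) (snd z))
        \<in> borel_measurable (borel \<Otimes>\<^sub>M borel)"
      by measurable
    also have "(\<lambda>z. \<Sum>i\<in>?S. \<Sum>j\<in>?S. H i j * indicator (T -` {i}) (fst z) * indicator (T -` {j}) (snd z))
        = (\<lambda>z. \<Sum>i\<in>?S. \<Sum>j\<in>?S. if T (snd z) = j then if T (fst z) = i then H i j else 0 else 0)"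
      by (intro ext sum.cong) (auto simp: indicator_def)
    also have "\<dots> = (\<lambda>z. H (T (fst z)) (T (snd z)))" by (simp add: sum.delta)
    finally show ?thesis by (simp add: borel_prod)
  qed
  have int\<mu>: "(\<integral>\<^sup>+ x. H (T x) \<partial>\<mu>) = (\<Sum>i\<in>?S. H i * ennreal (p i))" for H :: "'a \<Rightarrow> ennreal"
    using nn_integral_compose_simple[OF T\<mu>, of H] by (simp add: p_def M.emeasure_eq_measure)
  have int\<nu>: "(\<integral>\<^sup>+ x. H (T x) \<partial>\<nu>) = (\<Sum>i\<in>?S. H i * ennreal (q i))" for H :: "'a \<Rightarrow> ennreal"
    using nn_integral_compose_simple[OF T\<nu>, of H] by (simp add: q_def N.emeasure_eq_measure)
  have pos: "p i \<ge> 0" "q i \<ge> 0" for i by (auto simp: p_def q_def)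
  \<comment> \<open>For \<open>q j = 0\<close> the left side is 0, and so is the right side by
    \<open>wq\<close>; otherwise \<open>q j\<close> cancels.\<close>
  have Gq: "G i j * ennreal (q j) = ennreal (w i j / p i)" if "i \<in> ?S" "j \<in> ?S" for i j
    using that wq[of i j] w0 pos[of i] pos[of j]
    by (cases "q j = 0") (auto simp: G_def simp flip: ennreal_mult)
  have Gp: "G i j * ennreal (p i) = ennreal (w i j / q j)" if "i \<in> ?S" "j \<in> ?S" for i j
    using that wp[of i j] w0 pos[of i] pos[of j]
    by (cases "p i = 0") (auto simp: G_def simp flip: ennreal_mult)
  \<comment> \<open>The cells of measure zero are finitely many, so their union is null.\<close>
  have AEp: "AE x in \<mu>. p (T x) \<noteq> 0"
  proof -
    have "AE x in \<mu>. \<forall>i\<in>{i\<in>?S. p i = 0}. x \<notin> T -` {i}"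
      using Ti Prob_sets[OF \<mu>]
      by (intro AE_finite_allI AE_not_in null_setsI) (auto simp: p_def M.emeasure_eq_measure)
    then show ?thesis by eventually_elim auto
  qed
  have AEq: "AE x in \<nu>. q (T x) \<noteq> 0"
  proof -
    have "AE x in \<nu>. \<forall>i\<in>{i\<in>?S. q i = 0}. x \<notin> T -` {i}"
      using Ti Prob_sets[OF \<nu>]
      by (intro AE_finite_allI AE_not_in null_setsI) (auto simp: q_def N.emeasure_eq_measure)
    then show ?thesis by eventually_elim auto
  qed
  define g where "g = (\<lambda>z. G (T (fst z)) (T (snd z)))"
  have g: "g \<in> borel_measurable borel" unfolding g_def by (rule meas)
  have \<pi>: "density (\<mu> \<Otimes>\<^sub>M \<nu>) g \<in> couplings \<mu> \<nu>"
  proof (rule coupling_density[OF \<mu> \<nu> g])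
    show "AE x in \<mu>. (\<integral>\<^sup>+ y. g (x, y) \<partial>\<nu>) = 1" using AEp
    proof eventually_elim
      case (elim x)
      have "(\<integral>\<^sup>+ y. g (x, y) \<partial>\<nu>) = (\<Sum>j\<in>?S. ennreal (w (T x) j / p (T x)))"
        by (simp add: g_def int\<nu> Gq)
      also have "\<dots> = ennreal ((\<Sum>j\<in>?S. w (T x) j) / p (T x))"
        using w0 pos by (subst sum_ennreal) (auto simp: sum_divide_distrib)
      also have "\<dots> = 1" using elim w1 by (simp add: p_def)
      finally show ?case .
    qed
    show "AE y in \<nu>. (\<integral>\<^sup>+ x. g (x, y) \<partial>\<mu>) = 1" using AEq
    proof eventually_elim
      case (elim y)
      have "(\<integral>\<^sup>+ x. g (x, y) \<partial>\<mu>) = (\<Sum>i\<in>?S. ennreal (w i (T y) / q (T y)))"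
        using int\<mu>[of "\<lambda>i. G i (T y)"] by (simp add: g_def Gp)
      also have "\<dots> = ennreal ((\<Sum>i\<in>?S. w i (T y)) / q (T y))"
        using w0 pos by (subst sum_ennreal) (auto simp: sum_divide_distrib)
      also have "\<dots> = 1" using elim w2 by (simp add: q_def)
      finally show ?case .
    qed
  qed
  have sets: "sets (\<mu> \<Otimes>\<^sub>M \<nu>) = sets borel"
    using sets_pair_measure_cong[OF Prob_sets[OF \<mu>] Prob_sets[OF \<nu>]] unfolding borel_prod .
  define c where "c = (\<lambda>z. ennreal (dist (T (fst z)) (T (snd z))))"
  have c: "c \<in> borel_measurable borel"
    unfolding c_def by (rule meas[of "\<lambda>i j. ennreal (dist i j)"])
  have gc[measurable]: "g \<in> borel_measurable (\<mu> \<Otimes>\<^sub>M \<nu>)" "c \<in> borel_measurable (\<mu> \<Otimes>\<^sub>M \<nu>)"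
    using g c by (auto simp: measurable_cong_sets[OF sets refl])
  have "(\<integral>\<^sup>+ z. c z \<partial>density (\<mu> \<Otimes>\<^sub>M \<nu>) g) = (\<integral>\<^sup>+ x. \<integral>\<^sup>+ y. g (x, y) * c (x, y) \<partial>\<nu> \<partial>\<mu>)"
    by (subst nn_integral_density) (auto simp: N.nn_integral_fst[symmetric])
  also have "\<dots> = (\<integral>\<^sup>+ x. (\<Sum>j\<in>?S. ennreal (w (T x) j / p (T x) * dist (T x) j)) \<partial>\<mu>)"
  proof (rule nn_integral_cong)
    fix x
    have "(\<integral>\<^sup>+ y. g (x, y) * c (x, y) \<partial>\<nu>)
        = (\<Sum>j\<in>?S. G (T x) j * ennreal (dist (T x) j) * ennreal (q j))"
      using int\<nu>[of "\<lambda>j. G (T x) j * ennreal (dist (T x) j)"] by (simp add: g_def c_def)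
    also have "\<dots> = (\<Sum>j\<in>?S. ennreal (w (T x) j / p (T x) * dist (T x) j))"
    proof (intro sum.cong refl)
      fix j assume "j \<in> ?S"
      then have "ennreal (w (T x) j / p (T x) * dist (T x) j) = G (T x) j * ennreal (q j) * ennreal (dist (T x) j)"
        using w0 pos by (auto simp: Gq ennreal_mult simp del: times_divide_eq_left)
      then show "G (T x) j * ennreal (dist (T x) j) * ennreal (q j) = ennreal (w (T x) j / p (T x) * dist (T x) j)"
        by (simp add: ac_simps)
    qed
    finally show "(\<integral>\<^sup>+ y. g (x, y) * c (x, y) \<partial>\<nu>) = (\<Sum>j\<in>?S. ennreal (w (T x) j / p (T x) * dist (T x) j))" .
  qed
  also have "\<dots> = (\<Sum>i\<in>?S. (\<Sum>j\<in>?S. ennreal (w i j / p i * dist i j)) * ennreal (p i))"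
    using int\<mu>[of "\<lambda>i. \<Sum>j\<in>?S. ennreal (w i j / p i * dist i j)"] by simp
  also have "\<dots> = (\<Sum>i\<in>?S. \<Sum>j\<in>?S. ennreal (w i j * dist i j))"
  proof (intro sum.cong refl)
    fix i assume i: "i \<in> ?S"
    have "ennreal (w i j / p i * dist i j) * ennreal (p i) = ennreal (w i j * dist i j)" if "j \<in> ?S" for j
      using i that w0 wp[of i j] pos[of i]
      by (cases "p i = 0") (auto simp flip: ennreal_mult)
    then show "(\<Sum>j\<in>?S. ennreal (w i j / p i * dist i j)) * ennreal (p i) = (\<Sum>j\<in>?S. ennreal (w i j * dist i j))"
      by (simp add: sum_distrib_right)
  qed
  also have "\<dots> = (\<Sum>i\<in>?S. ennreal (\<Sum>j\<in>?S. w i j * dist i j))"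
    using w0 by (intro sum.cong refl sum_ennreal) auto
  also have "\<dots> = ennreal (\<Sum>i\<in>?S. \<Sum>j\<in>?S. w i j * dist i j)"
    using w0 by (intro sum_ennreal sum_nonneg) auto
  finally show ?thesis using \<pi> by (auto simp: c_def)
qed

subsection \<open>Kantorovich--Rubinstein duality\<close>


lemma W1_le_Lip_sup:
  fixes \<mu> \<nu> :: "'a::polish_space measure"
  assumes \<mu>: "\<mu> \<in> Prob1" and \<nu>: "\<nu> \<in> Prob1"
  shows "W1 \<mu> \<nu> \<le> (SUP f\<in>{f. Lip_norm UNIV f \<le> 1}. ennreal \<bar>(\<integral>x. f x \<partial>\<mu>) - (\<integral>x. f x \<partial>\<nu>)\<bar>)"
proof (rule ennreal_le_epsilon)
  fix e :: real assume e: "0 < e"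
  \<comment> \<open>Five errors are incurred: the slack of the finite duality, the replacement of F
    o T by F under each of \<mu> and \<nu>, and the displacement by \<open>T\<close> of each
    coordinate in the cost of the coupling.\<close>
  define \<epsilon> where "\<epsilon> = e / 5"
  have \<epsilon>: "\<epsilon> > 0" using e by (simp add: \<epsilon>_def)
  note P = Prob1_Prob[OF \<mu>] Prob1_Prob[OF \<nu>]
  interpret M: prob_space \<mu> by (rule Prob_prob_space[OF P(1)])
  interpret N: prob_space \<nu> by (rule Prob_prob_space[OF P(2)])
  note [measurable_cong] = Prob_sets[OF P(1)] Prob_sets[OF P(2)]
  note [simp] = Prob_space[OF P(1)] Prob_space[OF P(2)]
  obtain T where T: "simple_function borel T"
    and T\<mu>: "integrable \<mu> (\<lambda>x. dist x (T x))" "(\<integral>x. dist x (T x) \<partial>\<mu>) < \<epsilon>"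
    and T\<nu>: "integrable \<nu> (\<lambda>x. dist x (T x))" "(\<integral>x. dist x (T x) \<partial>\<nu>) < \<epsilon>"
    using simple_approximation[OF \<mu> \<nu> \<epsilon>] by metis
  let ?S = "range T"
  have Ts: "simple_function \<mu> T" "simple_function \<nu> T"
    using T Prob_sets[OF P(1)] Prob_sets[OF P(2)] by (auto simp: simple_function_def)
  have fin: "finite ?S" using T by (simp add: simple_function_def)
  have [measurable]: "T \<in> borel_measurable borel" by (rule borel_measurable_simple_function[OF T])
  have pull: "(\<integral>x. F (T x) \<partial>\<mu>) = (\<Sum>i\<in>?S. F i * measure \<mu> (T -` {i}))"
    "(\<integral>x. F (T x) \<partial>\<nu>) = (\<Sum>i\<in>?S. F i * measure \<nu> (T -` {i}))"
    "integrable \<mu> (\<lambda>x. F (T x))" "integrable \<nu> (\<lambda>x. F (T x))" for F :: "'a \<Rightarrow> real"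
  proof -
    have 1: "has_bochner_integral M (\<lambda>x. F (T x)) (\<Sum>i\<in>?S. F i * measure M (T -` {i}))"
      if M: "prob_space M" "simple_function M T" "space M = UNIV" for M
    proof -
      interpret prob_space M by (rule M(1))
      have "has_bochner_integral M (\<lambda>x. \<Sum>i\<in>?S. F i * indicator (T -` {i}) x) (\<Sum>i\<in>?S. F i * measure M (T -` {i}))"
        using M(2,3)
        by (intro has_bochner_integral_sum has_bochner_integral_mult_right has_bochner_integral_real_indicator)
          (auto simp: simple_function_def emeasure_eq_measure)
      also have "(\<lambda>x. \<Sum>i\<in>?S. F i * indicator (T -` {i}) x) = (\<lambda>x. \<Sum>i\<in>?S. if T x = i then F i else 0)"
        by (intro ext sum.cong) (auto simp: indicator_def)
      also have "\<dots> = (\<lambda>x. F (T x))" using fin by (simp add: sum.delta)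
      finally show ?thesis .
    qed
    show "(\<integral>x. F (T x) \<partial>\<mu>) = (\<Sum>i\<in>?S. F i * measure \<mu> (T -` {i}))" "integrable \<mu> (\<lambda>x. F (T x))"
      using 1[OF M.prob_space_axioms Ts(1)] by (auto simp: has_bochner_integral_iff)
    show "(\<integral>x. F (T x) \<partial>\<nu>) = (\<Sum>i\<in>?S. F i * measure \<nu> (T -` {i}))" "integrable \<nu> (\<lambda>x. F (T x))"
      using 1[OF N.prob_space_axioms Ts(2)] by (auto simp: has_bochner_integral_iff)
  qed
  have sum1: "(\<Sum>i\<in>?S. measure \<mu> (T -` {i})) = 1" "(\<Sum>i\<in>?S. measure \<nu> (T -` {i})) = 1"
    using pull(1,2)[of "\<lambda>_. 1"] M.prob_space N.prob_space by auto
  have "\<exists>w. (\<forall>i\<in>?S. \<forall>j\<in>?S. 0 \<le> w i j) \<and> (\<forall>i\<in>?S. (\<Sum>j\<in>?S. w i j) = measure \<mu> (T -` {i})) \<and>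
      (\<forall>j\<in>?S. (\<Sum>i\<in>?S. w i j) = measure \<nu> (T -` {j})) \<and>
      (\<forall>\<epsilon>>0. \<exists>f g. (\<forall>i\<in>?S. \<forall>j\<in>?S. f i + g j \<le> dist i j) \<and>
       (\<Sum>i\<in>?S. \<Sum>j\<in>?S. w i j * dist i j)
         \<le> (\<Sum>i\<in>?S. f i * measure \<mu> (T -` {i})) + (\<Sum>j\<in>?S. g j * measure \<nu> (T -` {j})) + \<epsilon>)"
    by (intro finite_transport_duality fin sum1 measure_nonneg)
  then obtain w where w: "\<forall>i\<in>?S. \<forall>j\<in>?S. 0 \<le> w i j"
    "\<forall>i\<in>?S. (\<Sum>j\<in>?S. w i j) = measure \<mu> (T -` {i})"
    "\<forall>j\<in>?S. (\<Sum>i\<in>?S. w i j) = measure \<nu> (T -` {j})"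
    and dual: "\<forall>\<epsilon>>0. \<exists>f g. (\<forall>i\<in>?S. \<forall>j\<in>?S. f i + g j \<le> dist i j) \<and>
       (\<Sum>i\<in>?S. \<Sum>j\<in>?S. w i j * dist i j)
         \<le> (\<Sum>i\<in>?S. f i * measure \<mu> (T -` {i})) + (\<Sum>j\<in>?S. g j * measure \<nu> (T -` {j})) + \<epsilon>"
    by (elim exE conjE) (rule that)
  obtain f g where fg: "\<And>i j. i \<in> ?S \<Longrightarrow> j \<in> ?S \<Longrightarrow> f i + g j \<le> dist i j"
    and cost: "(\<Sum>i\<in>?S. \<Sum>j\<in>?S. w i j * dist i j)
         \<le> (\<Sum>i\<in>?S. f i * measure \<mu> (T -` {i})) + (\<Sum>j\<in>?S. g j * measure \<nu> (T -` {j})) + \<epsilon>"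
    using dual[rule_format, OF \<epsilon>] by auto
  \<comment> \<open>The c-transform of \<open>g\<close>, a minimum of 1-Lipschitz functions. On
    \<open>range T\<close> it satisfies f \<le> F and g \<le> -F (take j = x), so replacing the pair
    (f, g) by (F, -F) does not lower the dual value, and \<open>F\<close> is defined on all of
    \<Theta>.\<close>
  define F where "F x = Min ((\<lambda>j. dist x j - g j) ` ?S)" for x
  have F_le: "F x \<le> dist x j - g j" if "j \<in> ?S" for x j
    unfolding F_def using that fin by (intro Min_le) auto
  have F_ge: "a \<le> F x" if "\<And>j. j \<in> ?S \<Longrightarrow> a \<le> dist x j - g j" for x a
    unfolding F_def using that fin by (subst Min_ge_iff) auto
  have F_sub: "F x - dist x y \<le> F y" for x y
  proof (rule F_ge)
    fix j assume "j \<in> ?S"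
    then show "F x - dist x y \<le> dist y j - g j"
      using F_le[of j x] dist_triangle[of x j y] by simp
  qed
  have F: "Lip_norm UNIV F \<le> 1"
    unfolding Lip_norm_le_1_iff
    using F_sub by (smt (verit) dist_commute)
  have close: "\<bar>(\<integral>x. F (T x) \<partial>M) - (\<integral>x. F x \<partial>M)\<bar> \<le> (\<integral>x. dist x (T x) \<partial>M)"
    if "integrable M (\<lambda>x. F (T x))" "integrable M F" "integrable M (\<lambda>x. dist x (T x))" for M
  proof -
    have "\<bar>(\<integral>x. F (T x) \<partial>M) - (\<integral>x. F x \<partial>M)\<bar> = \<bar>\<integral>x. F (T x) - F x \<partial>M\<bar>"
      using that by simp
    also have "\<dots> \<le> (\<integral>x. \<bar>F (T x) - F x\<bar> \<partial>M)" by (rule integral_abs_bound)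
    also have "\<dots> \<le> (\<integral>x. dist x (T x) \<partial>M)"
      using that F[unfolded Lip_norm_le_1_iff]
      by (intro integral_mono) (auto simp: dist_commute[of x "T x" for x])
    finally show ?thesis .
  qed
  have int: "integrable \<mu> F" "integrable \<nu> F"
    using Prob1_integrable_Lip \<mu> \<nu> F by auto
  have "(\<Sum>i\<in>?S. f i * measure \<mu> (T -` {i})) \<le> (\<integral>x. F (T x) \<partial>\<mu>)"
    unfolding pull by (intro sum_mono mult_right_mono F_ge) (use fg in \<open>auto simp: algebra_simps\<close>)
  moreover have "(\<Sum>i\<in>?S. g i * measure \<nu> (T -` {i})) \<le> (\<Sum>i\<in>?S. - F i * measure \<nu> (T -` {i}))"
  proof (intro sum_mono mult_right_mono measure_nonneg)
    show "g i \<le> - F i" if "i \<in> ?S" for i using F_le[OF that, of i] by simp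
  qed
  then have "(\<Sum>i\<in>?S. g i * measure \<nu> (T -` {i})) \<le> - (\<integral>x. F (T x) \<partial>\<nu>)"
    unfolding pull by (simp add: sum_negf)
  ultimately have c: "(\<Sum>i\<in>?S. \<Sum>j\<in>?S. w i j * dist i j) \<le> (\<integral>x. F x \<partial>\<mu>) - (\<integral>x. F x \<partial>\<nu>) + 3 * \<epsilon>"
    using cost close[OF pull(3) int(1) T\<mu>(1)] close[OF pull(4) int(2) T\<nu>(1)] T\<mu>(2) T\<nu>(2) by linarith
  obtain \<pi> where \<pi>: "\<pi> \<in> couplings \<mu> \<nu>" and \<pi>c:
    "(\<integral>\<^sup>+ z. ennreal (dist (T (fst z)) (T (snd z))) \<partial>\<pi>) = ennreal (\<Sum>i\<in>?S. \<Sum>j\<in>?S. w i j * dist i j)"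
    using glue_finite_coupling[OF P T w] by auto
  have s[measurable_cong]: "sets \<pi> = sets borel" and d: "distr \<pi> borel fst = \<mu>" "distr \<pi> borel snd = \<nu>"
    using \<pi> by (auto simp: couplings_def Prob_def)
  have [measurable]: "fst \<in> \<pi> \<rightarrow>\<^sub>M (borel :: 'a measure)" "snd \<in> \<pi> \<rightarrow>\<^sub>M (borel :: 'a measure)"
    by (auto simp: borel_prod[symmetric] measurable_cong_sets[OF s refl])
  have m: "(\<lambda>z. ennreal (dist (fst z) (T (fst z)))) \<in> borel_measurable \<pi>"
    "(\<lambda>z. ennreal (dist (T (fst z)) (T (snd z)))) \<in> borel_measurable \<pi>"
    "(\<lambda>z. ennreal (dist (snd z) (T (snd z)))) \<in> borel_measurable \<pi>"
    unfolding measurable_cong_sets[OF s refl] borel_prod[symmetric] by measurable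
  have "W1 \<mu> \<nu> \<le> (\<integral>\<^sup>+ z. ennreal (dist (fst z) (snd z)) \<partial>\<pi>)"
    unfolding W1_def by (rule INF_lower[OF \<pi>])
  also have "\<dots> \<le> (\<integral>\<^sup>+ z. ennreal (dist (fst z) (T (fst z))) + ennreal (dist (T (fst z)) (T (snd z)))
      + ennreal (dist (snd z) (T (snd z))) \<partial>\<pi>)"
  proof (rule nn_integral_mono)
    fix z
    have "dist (fst z) (snd z) \<le> dist (fst z) (T (fst z)) + dist (T (fst z)) (T (snd z)) + dist (snd z) (T (snd z))"
      using dist_triangle[of "fst z" "snd z" "T (fst z)"] dist_triangle[of "T (fst z)" "snd z" "T (snd z)"]
      by (simp add: dist_commute)
    then show "ennreal (dist (fst z) (snd z)) \<le> ennreal (dist (fst z) (T (fst z))) + ennreal (dist (T (fst z)) (T (snd z)))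
      + ennreal (dist (snd z) (T (snd z)))"
      by (simp flip: ennreal_plus add: ennreal_leI)
  qed
  also have "\<dots> = (\<integral>\<^sup>+ z. ennreal (dist (fst z) (T (fst z))) \<partial>\<pi>) + (\<integral>\<^sup>+ z. ennreal (dist (T (fst z)) (T (snd z))) \<partial>\<pi>)
      + (\<integral>\<^sup>+ z. ennreal (dist (snd z) (T (snd z))) \<partial>\<pi>)"
    by (subst nn_integral_add, intro borel_measurable_add m, rule m, subst nn_integral_add) (auto intro: m)
  also have "(\<integral>\<^sup>+ z. ennreal (dist (fst z) (T (fst z))) \<partial>\<pi>) = (\<integral>\<^sup>+ x. ennreal (dist x (T x)) \<partial>\<mu>)"
    unfolding d(1)[symmetric] by (subst nn_integral_distr) auto
  also have "\<dots> = ennreal (\<integral>x. dist x (T x) \<partial>\<mu>)"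
    using T\<mu>(1) by (intro nn_integral_eq_integral) auto
  also have "(\<integral>\<^sup>+ z. ennreal (dist (snd z) (T (snd z))) \<partial>\<pi>) = (\<integral>\<^sup>+ x. ennreal (dist x (T x)) \<partial>\<nu>)"
    unfolding d(2)[symmetric] by (subst nn_integral_distr) auto
  also have "\<dots> = ennreal (\<integral>x. dist x (T x) \<partial>\<nu>)"
    using T\<nu>(1) by (intro nn_integral_eq_integral) auto
  also have "ennreal (\<integral>x. dist x (T x) \<partial>\<mu>) + (\<integral>\<^sup>+ z. ennreal (dist (T (fst z)) (T (snd z))) \<partial>\<pi>)
      + ennreal (\<integral>x. dist x (T x) \<partial>\<nu>)
      \<le> ennreal \<epsilon> + ennreal (\<bar>(\<integral>x. F x \<partial>\<mu>) - (\<integral>x. F x \<partial>\<nu>)\<bar> + 3 * \<epsilon>) + ennreal \<epsilon>"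
    unfolding \<pi>c using T\<mu>(2) T\<nu>(2) c by (intro add_mono ennreal_leI) linarith+
  also have "\<dots> = ennreal \<bar>(\<integral>x. F x \<partial>\<mu>) - (\<integral>x. F x \<partial>\<nu>)\<bar> + ennreal e"
    using \<epsilon> e by (simp flip: ennreal_plus) (simp add: \<epsilon>_def)
  also have "\<dots> \<le> (SUP f\<in>{f. Lip_norm UNIV f \<le> 1}. ennreal \<bar>(\<integral>x. f x \<partial>\<mu>) - (\<integral>x. f x \<partial>\<nu>)\<bar>) + ennreal e"
    using F by (intro add_right_mono SUP_upper) auto
  finally show "W1 \<mu> \<nu> \<le> (SUP f\<in>{f. Lip_norm UNIV f \<le> 1}. ennreal \<bar>(\<integral>x. f x \<partial>\<mu>) - (\<integral>x. f x \<partial>\<nu>)\<bar>) + ennreal e" .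
qed

theorem kantorovich_rubinstein:
  fixes \<mu> \<nu> :: "'a::polish_space measure"
  assumes "\<mu> \<in> Prob1" "\<nu> \<in> Prob1"
  shows "W1 \<mu> \<nu> = (SUP f\<in>{f. Lip_norm UNIV f \<le> 1}. ennreal \<bar>(\<integral>x. f x \<partial>\<mu>) - (\<integral>x. f x \<partial>\<nu>)\<bar>)"
proof (rule antisym[OF W1_le_Lip_sup[OF assms]])
  show "(SUP f\<in>{f. Lip_norm UNIV f \<le> 1}. ennreal \<bar>(\<integral>x. f x \<partial>\<mu>) - (\<integral>x. f x \<partial>\<nu>)\<bar>) \<le> W1 \<mu> \<nu>"
    unfolding W1_def by (intro SUP_least INF_greatest coupling_cost_ge assms) auto
qed

section \<open>Attainment of the supremum\<close>

text \<open>An Arzela-Ascoli argument that uses separability: a diagonal subsequence converges on a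
  countable dense set, and the common Lipschitz bound carries the Cauchy property to every point and
  the Lipschitz bound to the limit.\<close>

lemma Lip_pointwise_compact:
  fixes f :: "nat \<Rightarrow> 'a::polish_space \<Rightarrow> real"
  assumes f: "\<And>n. Lip_norm UNIV (f n) \<le> 1" and z: "\<And>n. f n z = 0"
  shows "\<exists>k l. strict_mono (k :: nat \<Rightarrow> nat) \<and> (\<forall>x. (\<lambda>n. f (k n) x) \<longlonglongrightarrow> l x) \<and> Lip_norm UNIV l \<le> 1"
proof -
  have lip: "\<bar>f n x - f n y\<bar> \<le> dist x y" for n x y
    using f unfolding Lip_norm_le_1_iff by blast
  obtain D :: "'a set" where D: "countable D" "\<And>X. open X \<Longrightarrow> X \<noteq> {} \<Longrightarrow> \<exists>d\<in>D. d \<in> X"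
    by (erule countable_dense_setE)
  \<comment> \<open>The diagonal argument wants one bound for all points, whereas
    \<open>f n x\<close> is bounded only by \<open>dist x z\<close>. Dividing by a factor
    independent of n gives the bound 1 and is undone in \<open>conv\<close>.\<close>
  have "\<bar>f n x\<bar> / (1 + dist x z) \<le> 1" for n x
    using lip[of n x z] z[of n] by (simp add: field_simps)
  then have b: "norm (f n x / (1 + dist x z)) \<le> 1" for n x
    by simp
  obtain k :: "nat \<Rightarrow> nat" where k: "strict_mono k"
    "\<And>x. x \<in> D \<Longrightarrow> \<exists>l. (\<lambda>n. f (k n) x / (1 + dist x z)) \<longlonglongrightarrow> l"
    using function_convergent_subsequence[OF D(1), of "\<lambda>n x. f n x / (1 + dist x z)", OF b] by blast
  have conv: "convergent (\<lambda>n. f (k n) x)" if x: "x \<in> D" for x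
  proof -
    obtain l where "(\<lambda>n. f (k n) x / (1 + dist x z)) \<longlonglongrightarrow> l" using k(2)[OF x] by blast
    then have "(\<lambda>n. f (k n) x / (1 + dist x z) * (1 + dist x z)) \<longlonglongrightarrow> l * (1 + dist x z)"
      by (intro tendsto_intros)
    moreover have "1 + dist x z \<noteq> 0" using zero_le_dist[of x z] by linarith
    ultimately show ?thesis by (auto simp: convergent_def)
  qed
  have "Cauchy (\<lambda>n. f (k n) x)" for x
  proof (rule metric_CauchyI)
    fix e :: real assume "e > 0"
    then have "ball x (e / 3) \<noteq> {}" by simp
    then obtain d where d: "d \<in> D" "d \<in> ball x (e / 3)" using D(2)[OF open_ball] by blast
    obtain N where N: "\<And>m n. m \<ge> N \<Longrightarrow> n \<ge> N \<Longrightarrow> dist (f (k m) d) (f (k n) d) < e / 3"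
      using convergent_Cauchy[OF conv[OF d(1)]] \<open>e > 0\<close> by (metis metric_CauchyD zero_less_divide_iff zero_less_numeral)
    have "dist (f (k m) x) (f (k n) x) < e" if "m \<ge> N" "n \<ge> N" for m n
      using N[OF that] lip[of "k m" x d] lip[of "k n" x d] d(2) unfolding mem_ball dist_real_def by linarith
    then show "\<exists>M. \<forall>m\<ge>M. \<forall>n\<ge>M. dist (f (k m) x) (f (k n) x) < e" by blast
  qed
  then have lim: "(\<lambda>n. f (k n) x) \<longlonglongrightarrow> lim (\<lambda>n. f (k n) x)" for x
    by (simp add: real_Cauchy_convergent convergent_LIMSEQ_iff[symmetric])
  have "Lip_norm UNIV (\<lambda>x. lim (\<lambda>n. f (k n) x)) \<le> 1"
    unfolding Lip_norm_le_1_iff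
    by (intro allI LIMSEQ_le_const2[OF tendsto_rabs[OF tendsto_diff[OF lim lim]]]) (use lip in auto)
  with k(1) lim show ?thesis
    by (intro exI[of _ k] exI[of _ "\<lambda>x. lim (\<lambda>n. f (k n) x)"]) simp
qed

theorem kantorovich_rubinstein_attained:
  fixes \<mu> \<nu> :: "'a::polish_space measure"
  assumes \<mu>: "\<mu> \<in> Prob1" and \<nu>: "\<nu> \<in> Prob1"
  obtains f where "Lip_norm UNIV f \<le> 1" "W1 \<mu> \<nu> = ennreal \<bar>(\<integral>x. f x \<partial>\<mu>) - (\<integral>x. f x \<partial>\<nu>)\<bar>"
proof -
  interpret M: prob_space \<mu> by (rule Prob_prob_space[OF Prob1_Prob[OF \<mu>]])
  interpret N: prob_space \<nu> by (rule Prob_prob_space[OF Prob1_Prob[OF \<nu>]])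
  fix z :: 'a
  let ?L = "{f :: 'a \<Rightarrow> real. Lip_norm UNIV f \<le> 1}"
  define J where "J f = ennreal \<bar>(\<integral>x. f x \<partial>\<mu>) - (\<integral>x. f x \<partial>\<nu>)\<bar>" for f
  have "(\<lambda>_. 0) \<in> ?L" by (simp add: Lip_norm_le_1_iff)
  then have "?L \<noteq> {}" by blast
  then obtain s :: "nat \<Rightarrow> ennreal" where "incseq s" "range s \<subseteq> J ` ?L" "(SUP f\<in>?L. J f) = (SUP i. s i)"
    using ennreal_Sup_countable_SUP[of "J ` ?L"] by auto
  then have s: "range s \<subseteq> J ` ?L" "s \<longlonglongrightarrow> (SUP f\<in>?L. J f)"
    using LIMSEQ_SUP[of s] by auto
  then have "\<forall>n. \<exists>f. Lip_norm UNIV f \<le> 1 \<and> s n = J f" by blast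
  then obtain f where f: "\<And>n. Lip_norm UNIV (f n) \<le> 1" "\<And>n. s n = J (f n)" by metis
  \<comment> \<open>Subtracting a constant leaves \<open>J\<close> unchanged, as both measures have
    mass 1. The maximising sequence then vanishes at z and is dominated by
    \<open>dist z\<close>.\<close>
  define g where "g n x = f n x - f n z" for n x
  have g: "Lip_norm UNIV (g n) \<le> 1" for n
    using f(1)[of n] by (simp add: g_def Lip_norm_le_1_iff)
  have Jg: "J (g n) = s n" for n
    using Prob1_integrable_Lip[OF \<mu> f(1)[of n]] Prob1_integrable_Lip[OF \<nu> f(1)[of n]]
    unfolding f(2) by (simp add: J_def g_def[abs_def] M.prob_space N.prob_space)
  have gz: "g n z = 0" for n by (simp add: g_def)
  have "\<exists>k l. strict_mono (k :: nat \<Rightarrow> nat) \<and> (\<forall>x. (\<lambda>n. g (k n) x) \<longlonglongrightarrow> l x) \<and> Lip_norm UNIV l \<le> 1"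
    by (rule Lip_pointwise_compact[of g z]) (rule g gz)+
  then obtain k l where k: "strict_mono k" and lim: "\<And>x. (\<lambda>n. g (k n) x) \<longlonglongrightarrow> l x"
    and l: "Lip_norm UNIV l \<le> 1"
    by blast
  have bound: "norm (g n x) \<le> dist z x" for n x
    using g[of n] unfolding Lip_norm_le_1_iff by (metis (no_types, lifting) diff_0_right diff_self dist_commute g_def real_norm_def)
  have "(\<lambda>n. \<integral>x. g (k n) x \<partial>M) \<longlonglongrightarrow> (\<integral>x. l x \<partial>M)" if M: "M \<in> Prob1" for M
  proof (rule integral_dominated_convergence[OF _ _ Prob1_integrable_dist[OF M, of z]])
    show "l \<in> borel_measurable M" "\<And>i. g (k i) \<in> borel_measurable M"
      using Prob1_integrable_Lip[OF M] l g by auto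
  qed (use lim bound in auto)
  from this[OF \<mu>] this[OF \<nu>] have "(\<lambda>n. J (g (k n))) \<longlonglongrightarrow> J l"
    unfolding J_def by (intro tendsto_intros)
  moreover have "(\<lambda>n. J (g (k n))) \<longlonglongrightarrow> (SUP f\<in>?L. J f)"
    using LIMSEQ_subseq_LIMSEQ[OF s(2) k] by (simp add: Jg comp_def)
  ultimately have "(SUP f\<in>?L. J f) = J l" using LIMSEQ_unique by blast
  then show thesis using that[OF l] kantorovich_rubinstein[OF \<mu> \<nu>] by (simp add: J_def)
qed

subsection \<open>Gibbs measures\<close>


text \<open>A point outside the support lies in a null basic open set, and a countable basis has
  only countably many of these.\<close>

lemma AE_supp:
  fixes \<mu> :: "'a::second_countable_topology measure"
  assumes \<mu>: "\<mu> \<in> Prob"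
  shows "AE x in \<mu>. x \<in> supp \<mu>"
proof -
  obtain B :: "'a set set" where B: "countable B" "topological_basis B"
    using ex_countable_basis by blast
  let ?N = "{b \<in> B. emeasure \<mu> b = 0}"
  have "countable ?N" using B(1) by simp
  moreover have "AE x in \<mu>. x \<notin> b" if "b \<in> ?N" for b
    using that topological_basis_open[OF B(2)] Prob_sets[OF \<mu>] by (intro AE_not_in null_setsI) auto
  ultimately have "AE x in \<mu>. \<forall>b\<in>?N. x \<notin> b" by (subst AE_ball_countable) auto
  then show ?thesis
  proof eventually_elim
    case (elim x)
    have "0 < emeasure \<mu> U" if U: "open U" "x \<in> U" for U
    proof -
      obtain b where b: "b \<in> B" "x \<in> b" "b \<subseteq> U" using topological_basisE[OF B(2) U] by metis
      then have "0 < emeasure \<mu> b" using elim by (auto simp: zero_less_iff_neq_zero)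
      also have "\<dots> \<le> emeasure \<mu> U" using b(3) U(1) Prob_sets[OF \<mu>] by (intro emeasure_mono) auto
      finally show ?thesis .
    qed
    then show ?case by (simp add: supp_def)
  qed
qed

lemma supp_nonempty:
  fixes \<mu> :: "'a::second_countable_topology measure"
  assumes \<mu>: "\<mu> \<in> Prob"
  shows "supp \<mu> \<noteq> {}"
proof
  interpret prob_space \<mu> by (rule Prob_prob_space[OF \<mu>])
  assume "supp \<mu> = {}"
  then have "AE x in \<mu>. False" using AE_supp[OF \<mu>] by simp
  then show False by simp
qed

text \<open>McShane's extension, the infimal convolution of \<open>h\<close> with the metric; the
  Lipschitz bound on \<open>S\<close> makes the infimum finite and equal to \<open>h\<close> on
  \<open>S\<close>.\<close>

lemma Lip_extension:
  fixes h :: "'a::metric_space \<Rightarrow> real"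
  assumes S: "S \<noteq> {}" and h: "\<And>x y. x \<in> S \<Longrightarrow> y \<in> S \<Longrightarrow> \<bar>h x - h y\<bar> \<le> dist x y"
  obtains f where "Lip_norm UNIV f \<le> 1" "\<And>x. x \<in> S \<Longrightarrow> f x = h x"
proof -
  define f where "f x = (INF y\<in>S. h y + dist x y)" for x
  obtain s where s: "s \<in> S" using S by blast
  have "h s - dist x s \<le> h y + dist x y" if "y \<in> S" for x y
    using h[OF s that] dist_triangle[of s y x] by (simp add: dist_commute)
  then have bdd: "bdd_below ((\<lambda>y. h y + dist x y) ` S)" for x
    by (intro bdd_belowI2)
  have le: "f x \<le> h y + dist x y" if "y \<in> S" for x y
    unfolding f_def using that by (intro cINF_lower[OF bdd])
  have ge: "a \<le> f x" if "\<And>y. y \<in> S \<Longrightarrow> a \<le> h y + dist x y" for a x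
    unfolding f_def using S that by (intro cINF_greatest)
  have sub: "f x - dist x y \<le> f y" for x y
  proof (rule ge)
    fix u assume "u \<in> S"
    then show "f x - dist x y \<le> h u + dist y u"
      using le[of u x] dist_triangle[of x u y] by simp
  qed
  show thesis
  proof
    show "Lip_norm UNIV f \<le> 1"
      unfolding Lip_norm_le_1_iff using sub by (smt (verit) dist_commute)
    show "f x = h x" if "x \<in> S" for x
    proof (rule antisym)
      show "f x \<le> h x" using le[OF that, of x] by simp
      show "h x \<le> f x" using h[OF that] by (intro ge) fastforce
    qed
  qed
qed

section \<open>Norms and essential infimum\<close>

lemma Lp_norm_1: "Lp_norm 1 \<mu> f = (\<integral>\<^sup>+ x. ennreal \<bar>f x\<bar> \<partial>\<mu>)"
  by (auto simp: Lp_norm_def Let_def less_top)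

lemma Lp_norm_2_power2: "(Lp_norm 2 \<mu> f)\<^sup>2 = (\<integral>\<^sup>+ x. ennreal ((f x)\<^sup>2) \<partial>\<mu>)"
proof -
  have "(ennreal (enn2real I powr (1 / 2)))\<^sup>2 = I" if "I \<noteq> \<infinity>" for I
  proof -
    have "(ennreal (enn2real I powr (1 / 2)))\<^sup>2 = ennreal ((enn2real I powr (1 / 2))\<^sup>2)"
      by (simp add: ennreal_power)
    also have "(enn2real I powr (1 / 2))\<^sup>2 = enn2real I"
      by (simp add: powr_half_sqrt)
    finally show ?thesis using that by (simp add: less_top)
  qed
  then show ?thesis
    by (auto simp: Lp_norm_def Let_def power2_eq_square ennreal_top_mult)
qed

lemma essinf_ge: "AE x in \<mu>. c \<le> f x \<Longrightarrow> ereal c \<le> essinf \<mu> f"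
  unfolding essinf_def by (intro Liminf_bounded) simp

text \<open>A lower bound on a limes inferior speaks only about levels strictly below it, so the
  bound is reached through the countably many levels c - 1/(n+1).\<close>

lemma essinf_AE:
  assumes "ereal c \<le> essinf \<mu> f"
  shows "AE x in \<mu>. c \<le> f x"
proof -
  have "AE x in \<mu>. ereal (c - 1 / Suc n) < ereal (f x)" for n
  proof -
    have "ereal (c - 1 / Suc n) < ereal c" by simp
    then show ?thesis using assms unfolding essinf_def le_Liminf_iff by blast
  qed
  then have "AE x in \<mu>. \<forall>n. c - 1 / Suc n < f x" by (simp add: AE_all_countable)
  then show ?thesis
  proof eventually_elim
    case (elim x)
    show ?case
    proof (rule field_le_epsilon)
      fix e :: real assume "e > 0"
      then obtain n where "inverse (real (Suc n)) < e" using reals_Archimedean by blast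
      with elim[rule_format, of n] show "c \<le> f x + e" by (simp add: inverse_eq_divide)
    qed
  qed
qed

text \<open>As g \<ge> 0 almost everywhere, f = g + c is at least c. Used for both orders of the
  functions, it forces the shift to be 0.\<close>

lemma essinf_AE_shift_le:
  assumes "essinf \<mu> f = 0" "essinf \<mu> g = 0" "AE x in \<mu>. f x - g x = c"
  shows "c \<le> 0"
proof -
  have "AE x in \<mu>. 0 \<le> g x" using assms(2) by (intro essinf_AE) simp
  with assms(3) have "AE x in \<mu>. c \<le> f x" by eventually_elim simp
  from essinf_ge[OF this] show ?thesis using assms(1) by (simp add: zero_ereal_def)
qed

section \<open>Integrals against Gibbs measures and the upper bound\<close>

text \<open>With the real number \<open>z\<close> in place of \<open>Z \<mu> \<Phi>\<close> the
  change of density becomes an identity of Bochner integrals, available for signed \<open>f\<close>.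
  The case f = 1 recovers \<open>z\<close> itself as such an integral.\<close>

lemma gibbs_integral:
  fixes f :: "'a::polish_space \<Rightarrow> real"
  assumes \<mu>: "\<mu> \<in> Prob" and \<Phi>: "\<Phi> \<in> borel_measurable borel" and Z: "Z \<mu> \<Phi> = ennreal z" "0 < z"
    and f: "f \<in> borel_measurable borel" "integrable (gibbs \<mu> \<Phi>) f"
  shows "integrable \<mu> (\<lambda>x. f x * exp (- \<Phi> x))"
    and "(\<integral>x. f x * exp (- \<Phi> x) \<partial>\<mu>) = z * (\<integral>x. f x \<partial>gibbs \<mu> \<Phi>)"
proof -
  have [measurable]: "f \<in> borel_measurable \<mu>" "\<Phi> \<in> borel_measurable \<mu>"
    using f \<Phi> by (simp_all add: Prob_measurable[OF \<mu>])
  have g: "gibbs \<mu> \<Phi> = density \<mu> (\<lambda>x. ennreal (exp (- \<Phi> x) / z))"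
    unfolding gibbs_def Z(1) using Z(2) by (simp add: divide_ennreal)
  have "integrable \<mu> (\<lambda>x. exp (- \<Phi> x) / z * f x)"
    using f(2) Z(2) unfolding g by (subst (asm) integrable_density) auto
  then have "integrable \<mu> (\<lambda>x. z * (exp (- \<Phi> x) / z * f x))"
    by (rule integrable_mult_right)
  then show "integrable \<mu> (\<lambda>x. f x * exp (- \<Phi> x))"
    using Z(2) by (simp add: mult.commute)
  have "(\<integral>x. f x \<partial>gibbs \<mu> \<Phi>) = (\<integral>x. (f x * exp (- \<Phi> x)) / z \<partial>\<mu>)"
    using Z(2) unfolding g by (subst integral_density) (auto simp: mult.commute)
  then show "(\<integral>x. f x * exp (- \<Phi> x) \<partial>\<mu>) = z * (\<integral>x. f x \<partial>gibbs \<mu> \<Phi>)"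
    using Z(2) by simp
qed

text \<open>The two Gibbs measures have density difference \<open>D\<close> with respect to \<mu>,
  and \<open>D\<close> integrates to 0. An optimal \<open>f\<close> may thus be recentred at a point
  of the support, after which it is at most R(\<mu>) almost everywhere, and only the L^1 norm of
  \<open>D\<close> remains.\<close>

lemma gibbs_W1_le:
  fixes \<mu> :: "'a::polish_space measure"
  assumes \<mu>: "\<mu> \<in> Prob"
    and \<Phi>1: "\<Phi>1 \<in> borel_measurable borel" "Z \<mu> \<Phi>1 = ennreal z1" "0 < z1" "gibbs \<mu> \<Phi>1 \<in> Prob1"
    and \<Phi>2: "\<Phi>2 \<in> borel_measurable borel" "Z \<mu> \<Phi>2 = ennreal z2" "0 < z2" "gibbs \<mu> \<Phi>2 \<in> Prob1"
    and R: "R \<mu> < \<infinity>"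
  shows "W1 (gibbs \<mu> \<Phi>1) (gibbs \<mu> \<Phi>2)
    \<le> R \<mu> / max (Z \<mu> \<Phi>1) (Z \<mu> \<Phi>2) *
      (Lp_norm 1 \<mu> (\<lambda>x. exp (- \<Phi>1 x) - exp (- \<Phi>2 x)) + ennreal \<bar>z1 - z2\<bar>)"
proof -
  define e1 e2 where "e1 x = exp (- \<Phi>1 x)" and "e2 x = exp (- \<Phi>2 x)" for x
  define r where "r = enn2real (R \<mu>)"
  define m where "m = max z1 z2"
  have m: "m > 0" using \<Phi>1(3) by (simp add: m_def)
  have r: "R \<mu> = ennreal r" "0 \<le> r" using R by (auto simp: r_def less_top)
  obtain f where f: "Lip_norm UNIV f \<le> 1"
    "W1 (gibbs \<mu> \<Phi>1) (gibbs \<mu> \<Phi>2) = ennreal \<bar>(\<integral>x. f x \<partial>gibbs \<mu> \<Phi>1) - (\<integral>x. f x \<partial>gibbs \<mu> \<Phi>2)\<bar>"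
    by (rule kantorovich_rubinstein_attained[OF \<Phi>1(4) \<Phi>2(4)])
  obtain x0 where x0: "x0 \<in> supp \<mu>" using supp_nonempty[OF \<mu>] by blast
  note fm = Lip_le_1_measurable[OF f(1)]
  note i1 = gibbs_integral[OF \<mu> \<Phi>1(1,2,3) fm Prob1_integrable_Lip[OF \<Phi>1(4) f(1)], folded e1_def]
  note i2 = gibbs_integral[OF \<mu> \<Phi>2(1,2,3) fm Prob1_integrable_Lip[OF \<Phi>2(4) f(1)], folded e2_def]
  have one: "Lip_norm UNIV (\<lambda>_::'a. 1) \<le> 1" by (simp add: Lip_norm_le_1_iff)
  have prob: "prob_space (gibbs \<mu> \<Phi>1)" "prob_space (gibbs \<mu> \<Phi>2)"
    using \<Phi>1(4) \<Phi>2(4) by (auto intro: Prob_prob_space Prob1_Prob)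
  have c1: "integrable \<mu> e1" "(\<integral>x. e1 x \<partial>\<mu>) = z1"
    using gibbs_integral[OF \<mu> \<Phi>1(1,2,3) _ Prob1_integrable_Lip[OF \<Phi>1(4) one]] prob_space.prob_space[OF prob(1)]
    by (auto simp: e1_def[abs_def])
  have c2: "integrable \<mu> e2" "(\<integral>x. e2 x \<partial>\<mu>) = z2"
    using gibbs_integral[OF \<mu> \<Phi>2(1,2,3) _ Prob1_integrable_Lip[OF \<Phi>2(4) one]] prob_space.prob_space[OF prob(2)]
    by (auto simp: e2_def[abs_def])
  define D where "D x = e1 x / z1 - e2 x / z2" for x
  have D: "integrable \<mu> D" "(\<integral>x. D x \<partial>\<mu>) = 0"
    using c1 c2 \<Phi>1(3) \<Phi>2(3) by (auto simp: D_def[abs_def])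
  have fD: "integrable \<mu> (\<lambda>x. f x * D x)"
    "(\<integral>x. f x * D x \<partial>\<mu>) = (\<integral>x. f x \<partial>gibbs \<mu> \<Phi>1) - (\<integral>x. f x \<partial>gibbs \<mu> \<Phi>2)"
    using i1 i2 \<Phi>1(3) \<Phi>2(3) by (auto simp: D_def[abs_def] right_diff_distrib)
  define H where "H = (\<integral>x. \<bar>e1 x - e2 x\<bar> \<partial>\<mu>)"
  have H: "Lp_norm 1 \<mu> (\<lambda>x. exp (- \<Phi>1 x) - exp (- \<Phi>2 x)) = ennreal H" "0 \<le> H"
    unfolding Lp_norm_1 H_def e1_def[symmetric] e2_def[symmetric]
    using c1 c2 by (auto intro!: nn_integral_eq_integral)
  have "\<bar>\<integral>x. f x * D x \<partial>\<mu>\<bar> = \<bar>\<integral>x. (f x - f x0) * D x \<partial>\<mu>\<bar>"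
    using D fD(1) by (simp add: left_diff_distrib)
  also have "\<dots> \<le> (\<integral>x. \<bar>(f x - f x0) * D x\<bar> \<partial>\<mu>)" by (rule integral_abs_bound)
  also have "\<dots> \<le> (\<integral>x. r * \<bar>D x\<bar> \<partial>\<mu>)"
  proof (rule integral_mono_AE)
    show "integrable \<mu> (\<lambda>x. \<bar>(f x - f x0) * D x\<bar>)"
      using D fD(1) by (simp add: left_diff_distrib)
    show "AE x in \<mu>. \<bar>(f x - f x0) * D x\<bar> \<le> r * \<bar>D x\<bar>" using AE_supp[OF \<mu>]
    proof eventually_elim
      case (elim x)
      have "ennreal (dist x x0) \<le> R \<mu>"
        unfolding R_def using elim x0 by (intro SUP_upper2[of "(x, x0)"]) auto
      then have "dist x x0 \<le> r" using r by (simp add: ennreal_le_iff)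
      moreover have "\<bar>f x - f x0\<bar> \<le> dist x x0" using f(1) by (simp add: Lip_norm_le_1_iff)
      ultimately show ?case by (simp add: abs_mult mult_right_mono)
    qed
  qed (use D in simp)
  also have "\<dots> = r * (\<integral>x. \<bar>D x\<bar> \<partial>\<mu>)" by simp
  \<comment> \<open>The difference e1 - e2 is put over the larger normalising constant, which yields
    the maximum in the denominator. The correction then has one sign, and its absolute integral is
    exactly |z1 - z2| / m.\<close>
  also have "(\<integral>x. \<bar>D x\<bar> \<partial>\<mu>) \<le> (H + \<bar>z1 - z2\<bar>) / m"
  proof (cases "z2 \<le> z1")
    case True
    have "(\<integral>x. \<bar>D x\<bar> \<partial>\<mu>) \<le> (\<integral>x. \<bar>e1 x - e2 x\<bar> / z1 + e2 x * (1 / z2 - 1 / z1) \<partial>\<mu>)"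
    proof (rule integral_mono)
      fix x
      have "D x = (e1 x - e2 x) / z1 - e2 x * (1 / z2 - 1 / z1)"
        by (simp add: D_def diff_divide_distrib algebra_simps)
      then have "\<bar>D x\<bar> \<le> \<bar>(e1 x - e2 x) / z1\<bar> + \<bar>e2 x * (1 / z2 - 1 / z1)\<bar>" by linarith
      also have "\<bar>(e1 x - e2 x) / z1\<bar> = \<bar>e1 x - e2 x\<bar> / z1" using \<Phi>1(3) by (simp add: abs_divide)
      also have "\<bar>e2 x * (1 / z2 - 1 / z1)\<bar> = e2 x * (1 / z2 - 1 / z1)"
        using True \<Phi>1(3) \<Phi>2(3) by (intro abs_of_nonneg mult_nonneg_nonneg) (auto simp: e2_def frac_le)
      finally show "\<bar>D x\<bar> \<le> \<bar>e1 x - e2 x\<bar> / z1 + e2 x * (1 / z2 - 1 / z1)" .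
    qed (use D c1 c2 in auto)
    also have "\<dots> = H / z1 + z2 * (1 / z2 - 1 / z1)"
      using c1 c2 by (simp add: H_def)
    also have "\<dots> = (H + \<bar>z1 - z2\<bar>) / m"
      using True \<Phi>1(3) \<Phi>2(3) by (simp add: m_def field_simps)
    finally show ?thesis .
  next
    case False
    have "(\<integral>x. \<bar>D x\<bar> \<partial>\<mu>) \<le> (\<integral>x. \<bar>e1 x - e2 x\<bar> / z2 + e1 x * (1 / z1 - 1 / z2) \<partial>\<mu>)"
    proof (rule integral_mono)
      fix x
      have "D x = (e1 x - e2 x) / z2 + e1 x * (1 / z1 - 1 / z2)"
        by (simp add: D_def diff_divide_distrib algebra_simps)
      then have "\<bar>D x\<bar> \<le> \<bar>(e1 x - e2 x) / z2\<bar> + \<bar>e1 x * (1 / z1 - 1 / z2)\<bar>" by linarith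
      also have "\<bar>(e1 x - e2 x) / z2\<bar> = \<bar>e1 x - e2 x\<bar> / z2" using \<Phi>2(3) by (simp add: abs_divide)
      also have "\<bar>e1 x * (1 / z1 - 1 / z2)\<bar> = e1 x * (1 / z1 - 1 / z2)"
        using False \<Phi>1(3) \<Phi>2(3) by (intro abs_of_nonneg mult_nonneg_nonneg) (auto simp: e1_def frac_le)
      finally show "\<bar>D x\<bar> \<le> \<bar>e1 x - e2 x\<bar> / z2 + e1 x * (1 / z1 - 1 / z2)" .
    qed (use D c1 c2 in auto)
    also have "\<dots> = H / z2 + z1 * (1 / z1 - 1 / z2)"
      using c1 c2 by (simp add: H_def)
    also have "\<dots> = (H + \<bar>z1 - z2\<bar>) / m"
      using False \<Phi>1(3) \<Phi>2(3) by (simp add: m_def field_simps)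
    finally show ?thesis .
  qed
  finally have "\<bar>\<integral>x. f x * D x \<partial>\<mu>\<bar> \<le> r * ((H + \<bar>z1 - z2\<bar>) / m)"
    using r(2) by (simp add: mult_left_mono)
  then have "W1 (gibbs \<mu> \<Phi>1) (gibbs \<mu> \<Phi>2) \<le> ennreal (r / m * (H + \<bar>z1 - z2\<bar>))"
    unfolding f(2) fD(2)[symmetric] by (intro ennreal_leI) simp
  also have "\<dots> = ennreal (r / m) * (ennreal H + ennreal \<bar>z1 - z2\<bar>)"
    using H(2) r(2) m by (subst ennreal_mult) simp_all
  also have "ennreal (r / m) = R \<mu> / max (Z \<mu> \<Phi>1) (Z \<mu> \<Phi>2)"
    using r m \<Phi>1(3) \<Phi>2(3)
    by (auto simp: divide_ennreal[symmetric] m_def \<Phi>1(2) \<Phi>2(2) max_def ennreal_le_iff2)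
  finally show ?thesis unfolding H(1) .
qed

lemma abs_exp_diff_le:
  fixes a b :: real
  assumes "0 \<le> a" "0 \<le> b"
  shows "\<bar>exp (- a) - exp (- b)\<bar> \<le> \<bar>a - b\<bar>"
proof -
  have *: "exp (- x) - exp (- y) \<le> y - x" if "0 \<le> x" "x \<le> y" for x y :: real
  proof -
    have "exp (- x) - exp (- y) = exp (- x) * (1 - exp (x - y))"
      by (simp add: algebra_simps flip: exp_add)
    also have "\<dots> \<le> 1 * (y - x)"
      using that exp_ge_add_one_self[of "x - y"] by (intro mult_mono) (auto simp: algebra_simps)
    finally show ?thesis by simp
  qed
  show ?thesis using *[of a b] *[of b a] assms by (cases "a \<le> b") auto
qed

text \<open>On values up to \<open>M\<close> the slope of exp(-x) has modulus at least exp(-M);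
  concretely, exp(-y) is factored out at the larger argument and exp(t) - 1 \<ge> t is
  applied.\<close>

lemma abs_exp_diff_ge:
  fixes a b M :: real
  assumes "a \<le> M" "b \<le> M"
  shows "exp (- M) * \<bar>a - b\<bar> \<le> \<bar>exp (- a) - exp (- b)\<bar>"
proof -
  have *: "exp (- M) * (y - x) \<le> exp (- x) - exp (- y)" if "x \<le> y" "y \<le> M" for x y :: real
  proof -
    have "exp (- M) * (y - x) \<le> exp (- y) * (exp (y - x) - 1)"
      using that exp_ge_add_one_self[of "y - x"] by (intro mult_mono) (auto simp: algebra_simps)
    also have "\<dots> = exp (- x) - exp (- y)"
      by (simp add: algebra_simps flip: exp_add)
    finally show ?thesis .
  qed
  show ?thesis using *[of a b] *[of b a] assms by (cases "a \<le> b") auto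
qed

lemma Linf_AE_le:
  assumes "f \<in> Linf \<mu>"
  shows "AE x in \<mu>. \<bar>f x\<bar> \<le> enn2real (Linf_norm \<mu> f)"
proof -
  have "AE x in \<mu>. ennreal \<bar>f x\<bar> \<le> Linf_norm \<mu> f"
    unfolding Linf_norm_def by (rule esssup_AE)
  moreover have "Linf_norm \<mu> f = ennreal (enn2real (Linf_norm \<mu> f))"
    using assms by (simp add: Linf_def less_top)
  ultimately have "AE x in \<mu>. ennreal \<bar>f x\<bar> \<le> ennreal (enn2real (Linf_norm \<mu> f))" by simp
  then show ?thesis by (auto simp: ennreal_le_iff)
qed

section \<open>The bounds and the duality formula for perturbed measures\<close>

theorem proposition6p1:
  fixes \<mu> :: "'a::polish_space measure" and \<Phi>1 \<Phi>2 :: "'a \<Rightarrow> real"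
  assumes "\<mu> \<in> Prob"
    and "\<Phi>1 \<in> borel_measurable borel" and "\<Phi>2 \<in> borel_measurable borel"
    and "0 < Z \<mu> \<Phi>1" and "Z \<mu> \<Phi>1 < \<infinity>" and "gibbs \<mu> \<Phi>1 \<in> Prob1"
    and "0 < Z \<mu> \<Phi>2" and "Z \<mu> \<Phi>2 < \<infinity>" and "gibbs \<mu> \<Phi>2 \<in> Prob1"
  shows
    "let W = W1 (gibbs \<mu> \<Phi>1) (gibbs \<mu> \<Phi>2);
         Z1 = Z \<mu> \<Phi>1;
         Z2 = Z \<mu> \<Phi>2;
         h = (\<lambda>x. exp (- \<Phi>1 x) - exp (- \<Phi>2 x));
         B = R \<mu> / max Z1 Z2 * (Lp_norm 1 \<mu> h + ennreal \<bar>enn2real Z1 - enn2real Z2\<bar>);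
         J = (\<lambda>f. ennreal \<bar>(\<integral>x. f x * h x \<partial>\<mu>)
                    + (\<integral>x. f x \<partial>gibbs \<mu> \<Phi>2) * (enn2real Z2 - enn2real Z1)\<bar>);
         F = {f :: 'a \<Rightarrow> real. Lip_norm UNIV f \<le> 1}
     in
      (R \<mu> < \<infinity> \<and> essinf \<mu> \<Phi>1 = 0 \<and> essinf \<mu> \<Phi>2 = 0 \<longrightarrow>
         W \<le> B \<and>
         ((AE x in \<mu>. \<Phi>1 x = \<Phi>2 x) \<longrightarrow> W = B) \<and>
         (\<forall>c. c \<noteq> 0 \<and> (AE x in \<mu>. \<Phi>1 x - \<Phi>2 x = c) \<longrightarrow> W \<noteq> B) \<and>
         (\<Phi>1 \<in> Lp 1 \<mu> \<and> \<Phi>2 \<in> Lp 1 \<mu> \<longrightarrow>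
            W \<le> R \<mu> / max Z1 Z2 *
                  (Lp_norm 1 \<mu> (\<lambda>x. \<Phi>1 x - \<Phi>2 x) + ennreal \<bar>enn2real Z1 - enn2real Z2\<bar>))) \<and>
      W = 1 / Z1 * (SUP f\<in>F. J f) \<and>
      (\<exists>f\<in>F. J f = (SUP g\<in>F. J g)) \<and>
      (Z1 = Z2 \<and> 0 < Lip_norm (supp \<mu>) h \<and> Lip_norm (supp \<mu>) h < \<infinity> \<longrightarrow>
         W \<ge> 1 / Z1 * ((Lp_norm 2 \<mu> h)\<^sup>2 / Lip_norm (supp \<mu>) h) \<and>
         (\<Phi>1 \<in> Linf \<mu> \<and> \<Phi>2 \<in> Linf \<mu> \<longrightarrow>
            W \<ge> ennreal (min (exp (- 2 * enn2real (Linf_norm \<mu> \<Phi>1)))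
                              (exp (- 2 * enn2real (Linf_norm \<mu> \<Phi>2)))) / Z1 *
                 ((Lp_norm 2 \<mu> (\<lambda>x. \<Phi>1 x - \<Phi>2 x))\<^sup>2 / Lip_norm (supp \<mu>) h)))"
proof -
  note \<mu> = assms(1)
  interpret M: prob_space \<mu> by (rule Prob_prob_space[OF \<mu>])
  define z1 z2 where "z1 = enn2real (Z \<mu> \<Phi>1)" and "z2 = enn2real (Z \<mu> \<Phi>2)"
  have z1: "Z \<mu> \<Phi>1 = ennreal z1" "0 < z1" and z2: "Z \<mu> \<Phi>2 = ennreal z2" "0 < z2"
    using assms(4,5,7,8) by (auto simp: z1_def z2_def enn2real_positive_iff less_top)
  define W where "W = W1 (gibbs \<mu> \<Phi>1) (gibbs \<mu> \<Phi>2)"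
  define h where "h = (\<lambda>x. exp (- \<Phi>1 x) - exp (- \<Phi>2 x))"
  define B where "B = R \<mu> / max (Z \<mu> \<Phi>1) (Z \<mu> \<Phi>2) * (Lp_norm 1 \<mu> h + ennreal \<bar>z1 - z2\<bar>)"
  define J where "J = (\<lambda>f. ennreal \<bar>(\<integral>x. f x * h x \<partial>\<mu>) + (\<integral>x. f x \<partial>gibbs \<mu> \<Phi>2) * (z2 - z1)\<bar>)"
  define F where "F = {f :: 'a \<Rightarrow> real. Lip_norm UNIV f \<le> 1}"
  have [measurable]: "\<Phi>1 \<in> borel_measurable \<mu>" "\<Phi>2 \<in> borel_measurable \<mu>"
    using assms(2,3) by (simp_all add: Prob_measurable[OF \<mu>])
  have fh: "integrable \<mu> (\<lambda>x. f x * h x)"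
    "J f = ennreal z1 * ennreal \<bar>(\<integral>x. f x \<partial>gibbs \<mu> \<Phi>1) - (\<integral>x. f x \<partial>gibbs \<mu> \<Phi>2)\<bar>" if "f \<in> F" for f
  proof -
    have f: "Lip_norm UNIV f \<le> 1" using that by (simp add: F_def)
    note fm = Lip_le_1_measurable[OF f]
    note i1 = gibbs_integral[OF \<mu> assms(2) z1 fm Prob1_integrable_Lip[OF assms(6) f]]
    note i2 = gibbs_integral[OF \<mu> assms(3) z2 fm Prob1_integrable_Lip[OF assms(9) f]]
    show "integrable \<mu> (\<lambda>x. f x * h x)"
      using i1(1) i2(1) by (simp add: h_def right_diff_distrib)
    have "(\<integral>x. f x * h x \<partial>\<mu>) = z1 * (\<integral>x. f x \<partial>gibbs \<mu> \<Phi>1) - z2 * (\<integral>x. f x \<partial>gibbs \<mu> \<Phi>2)"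
      using i1 i2 by (simp add: h_def right_diff_distrib)
    \<comment> \<open>The added term cancels the multiple \<open>z2\<close> of the second integral
      and replaces it by the multiple \<open>z1\<close>, so that \<open>z1\<close> factors
      out.\<close>
    then have "(\<integral>x. f x * h x \<partial>\<mu>) + (\<integral>x. f x \<partial>gibbs \<mu> \<Phi>2) * (z2 - z1)
        = z1 * ((\<integral>x. f x \<partial>gibbs \<mu> \<Phi>1) - (\<integral>x. f x \<partial>gibbs \<mu> \<Phi>2))"
      by (simp add: algebra_simps)
    then show "J f = ennreal z1 * ennreal \<bar>(\<integral>x. f x \<partial>gibbs \<mu> \<Phi>1) - (\<integral>x. f x \<partial>gibbs \<mu> \<Phi>2)\<bar>"
      using z1(2) by (simp add: J_def abs_mult ennreal_mult)
  qed
  have "(SUP f\<in>F. J f) = (SUP f\<in>F. ennreal z1 * ennreal \<bar>(\<integral>x. f x \<partial>gibbs \<mu> \<Phi>1) - (\<integral>x. f x \<partial>gibbs \<mu> \<Phi>2)\<bar>)"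
    by (intro SUP_cong refl fh)
  also have "\<dots> = ennreal z1 * W"
    unfolding W_def kantorovich_rubinstein[OF assms(6,9)] F_def by (simp add: SUP_mult_left_ennreal)
  finally have SUP: "(SUP f\<in>F. J f) = ennreal z1 * W" .
  have dual: "W = 1 / Z \<mu> \<Phi>1 * (SUP f\<in>F. J f)"
    unfolding SUP z1(1) using z1(2)
    by (simp add: ennreal_divide_times mult.assoc[symmetric] ennreal_divide_self)
  have attained: "\<exists>f\<in>F. J f = (SUP g\<in>F. J g)"
  proof -
    obtain f where f: "Lip_norm UNIV f \<le> 1"
      "W1 (gibbs \<mu> \<Phi>1) (gibbs \<mu> \<Phi>2) = ennreal \<bar>(\<integral>x. f x \<partial>gibbs \<mu> \<Phi>1) - (\<integral>x. f x \<partial>gibbs \<mu> \<Phi>2)\<bar>"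
      by (rule kantorovich_rubinstein_attained[OF assms(6,9)])
    then have "f \<in> F" by (simp add: F_def)
    then show ?thesis using fh(2)[of f] f(2) SUP by (auto simp: W_def)
  qed
  have upper: "W \<le> B" if "R \<mu> < \<infinity>"
    unfolding W_def B_def h_def
    by (rule gibbs_W1_le[OF \<mu> assms(2) z1 assms(6) assms(3) z2 assms(9) that])
  have upper': "W \<le> R \<mu> / max (Z \<mu> \<Phi>1) (Z \<mu> \<Phi>2) *
      (Lp_norm 1 \<mu> (\<lambda>x. \<Phi>1 x - \<Phi>2 x) + ennreal \<bar>z1 - z2\<bar>)"
    if "R \<mu> < \<infinity>" "essinf \<mu> \<Phi>1 = 0" "essinf \<mu> \<Phi>2 = 0"
  proof -
    \<comment> \<open>The normalisation makes both functions nonnegative almost everywhere, and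
      there exp(-x) is 1-Lipschitz.\<close>
    have "AE x in \<mu>. 0 \<le> \<Phi>1 x" "AE x in \<mu>. 0 \<le> \<Phi>2 x"
      using that(2,3) by (auto intro!: essinf_AE simp flip: zero_ereal_def)
    then have "AE x in \<mu>. ennreal \<bar>h x\<bar> \<le> ennreal \<bar>\<Phi>1 x - \<Phi>2 x\<bar>"
      by eventually_elim (auto simp: h_def intro!: ennreal_leI abs_exp_diff_le)
    then have "Lp_norm 1 \<mu> h \<le> Lp_norm 1 \<mu> (\<lambda>x. \<Phi>1 x - \<Phi>2 x)"
      unfolding Lp_norm_1 by (rule nn_integral_mono_AE)
    then show ?thesis
      by (intro order_trans[OF upper[OF that(1)]]) (simp add: B_def mult_left_mono add_right_mono)
  qed
  \<comment> \<open>Here \<open>B\<close> is 0, so equality already follows from the upper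
    bound.\<close>
  have equal: "W = B" if "R \<mu> < \<infinity>" "AE x in \<mu>. \<Phi>1 x = \<Phi>2 x"
  proof -
    have "Z \<mu> \<Phi>1 = Z \<mu> \<Phi>2"
      unfolding Z_def using that(2) by (intro nn_integral_cong_AE) auto
    then have "z1 = z2" by (simp add: z1_def z2_def)
    moreover have "Lp_norm 1 \<mu> h = 0"
      unfolding Lp_norm_1 using that(2) by (subst nn_integral_0_iff_AE) (auto simp: h_def)
    ultimately have "B = 0" by (simp add: B_def)
    with upper[OF that(1)] show ?thesis by simp
  qed
  \<comment> \<open>The claim W \<noteq> B holds because its premises are contradictory: essential
    infima 0 on both sides bound c and -c by 0.\<close>
  have unequal: False
    if "essinf \<mu> \<Phi>1 = 0" "essinf \<mu> \<Phi>2 = 0" "c \<noteq> 0" "AE x in \<mu>. \<Phi>1 x - \<Phi>2 x = c" for c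
  proof -
    have "AE x in \<mu>. \<Phi>2 x - \<Phi>1 x = - c" using that(4) by eventually_elim simp
    with essinf_AE_shift_le[OF that(1,2,4)] essinf_AE_shift_le[OF that(2,1)] that(3)
    show False by fastforce
  qed
  have lower: "W \<ge> 1 / Z \<mu> \<Phi>1 * ((Lp_norm 2 \<mu> h)\<^sup>2 / Lip_norm (supp \<mu>) h)"
    if Z: "Z \<mu> \<Phi>1 = Z \<mu> \<Phi>2" and L: "0 < Lip_norm (supp \<mu>) h" "Lip_norm (supp \<mu>) h < \<infinity>"
  proof -
    define l where "l = enn2real (Lip_norm (supp \<mu>) h)"
    have l: "Lip_norm (supp \<mu>) h = ennreal l" "0 < l"
      using L by (auto simp: l_def enn2real_positive_iff less_top)
    have "\<forall>x\<in>supp \<mu>. \<forall>y\<in>supp \<mu>. \<bar>h x - h y\<bar> \<le> l * dist x y"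
      using Lip_norm_le_iff[of l "supp \<mu>" h] l by simp
    then have hl: "\<bar>h x / l - h y / l\<bar> \<le> dist x y" if "x \<in> supp \<mu>" "y \<in> supp \<mu>" for x y
      using that l(2) by (simp add: diff_divide_distrib[symmetric] abs_divide field_simps)
    obtain f where f: "Lip_norm UNIV f \<le> 1" "\<And>x. x \<in> supp \<mu> \<Longrightarrow> f x = h x / l"
      using Lip_extension[of "supp \<mu>" "\<lambda>x. h x / l"] supp_nonempty[OF \<mu>] hl by metis
    then have fF: "f \<in> F" by (simp add: F_def)
    have AE: "AE x in \<mu>. f x * h x = (h x)\<^sup>2 / l"
      using AE_supp[OF \<mu>] by eventually_elim (simp add: f(2) power2_eq_square)
    have [measurable]: "h \<in> borel_measurable \<mu>" by (simp add: h_def)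
    \<comment> \<open>Square integrability of \<open>h\<close> is derived, not assumed: almost
      everywhere the function equals \<open>f x * h x\<close>, which is integrable since
      \<open>f\<close> is Lipschitz.\<close>
    have "integrable \<mu> (\<lambda>x. (h x)\<^sup>2 / l)"
      by (rule integrable_cong_AE_imp[OF fh(1)[OF fF]]) (use AE in \<open>auto simp: eq_commute\<close>)
    then have "integrable \<mu> (\<lambda>x. l * ((h x)\<^sup>2 / l))" by (rule integrable_mult_right)
    then have int: "integrable \<mu> (\<lambda>x. (h x)\<^sup>2)" using l(2) by simp
    have "(Lp_norm 2 \<mu> h)\<^sup>2 / Lip_norm (supp \<mu>) h = ennreal (\<integral>x. (h x)\<^sup>2 \<partial>\<mu>) / ennreal l"
      unfolding Lp_norm_2_power2 l(1) using int by (subst nn_integral_eq_integral) auto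
    also have "\<dots> = ennreal ((\<integral>x. (h x)\<^sup>2 \<partial>\<mu>) / l)"
      using l(2) by (simp add: divide_ennreal)
    also have "(\<integral>x. (h x)\<^sup>2 \<partial>\<mu>) / l = (\<integral>x. f x * h x \<partial>\<mu>)"
      using AE fh(1)[OF fF] by (subst integral_cong_AE[of _ _ "\<lambda>x. (h x)\<^sup>2 / l"]) auto
    \<comment> \<open>Equal normalising constants remove the second term of
      \<open>J\<close>.\<close>
    also have "ennreal (\<integral>x. f x * h x \<partial>\<mu>) \<le> J f"
      using Z by (simp add: J_def z1_def z2_def ennreal_leI)
    also have "\<dots> \<le> (SUP f\<in>F. J f)" using fF by (rule SUP_upper)
    finally show ?thesis unfolding dual by (rule mult_left_mono) simp
  qed
  have lower': "W \<ge> ennreal (min (exp (- 2 * enn2real (Linf_norm \<mu> \<Phi>1))) (exp (- 2 * enn2real (Linf_norm \<mu> \<Phi>2)))) / Z \<mu> \<Phi>1 *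
      ((Lp_norm 2 \<mu> (\<lambda>x. \<Phi>1 x - \<Phi>2 x))\<^sup>2 / Lip_norm (supp \<mu>) h)"
    if Z: "Z \<mu> \<Phi>1 = Z \<mu> \<Phi>2" and L: "0 < Lip_norm (supp \<mu>) h" "Lip_norm (supp \<mu>) h < \<infinity>"
      and \<Phi>: "\<Phi>1 \<in> Linf \<mu>" "\<Phi>2 \<in> Linf \<mu>"
  proof -
    \<comment> \<open>With the larger of the two norms, exp(-N) bounds the slope of exp(-x) from
      below along both functions; squaring it gives the minimum of the two factors exp(-2
      norm).\<close>
    define N where "N = max (enn2real (Linf_norm \<mu> \<Phi>1)) (enn2real (Linf_norm \<mu> \<Phi>2))"
    have min: "min (exp (- 2 * enn2real (Linf_norm \<mu> \<Phi>1))) (exp (- 2 * enn2real (Linf_norm \<mu> \<Phi>2))) = (exp (- N))\<^sup>2"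
      by (auto simp: N_def min_def max_def simp flip: exp_double)
    have "ennreal ((exp (- N))\<^sup>2) * (Lp_norm 2 \<mu> (\<lambda>x. \<Phi>1 x - \<Phi>2 x))\<^sup>2
        = (\<integral>\<^sup>+ x. ennreal ((exp (- N))\<^sup>2) * ennreal ((\<Phi>1 x - \<Phi>2 x)\<^sup>2) \<partial>\<mu>)"
      unfolding Lp_norm_2_power2 by (rule nn_integral_cmult[symmetric]) measurable
    also have "\<dots> \<le> (\<integral>\<^sup>+ x. ennreal ((h x)\<^sup>2) \<partial>\<mu>)"
    proof (rule nn_integral_mono_AE)
      show "AE x in \<mu>. ennreal ((exp (- N))\<^sup>2) * ennreal ((\<Phi>1 x - \<Phi>2 x)\<^sup>2) \<le> ennreal ((h x)\<^sup>2)"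
        using Linf_AE_le[OF \<Phi>(1)] Linf_AE_le[OF \<Phi>(2)]
      proof eventually_elim
        case (elim x)
        have "(exp (- N) * \<bar>\<Phi>1 x - \<Phi>2 x\<bar>)\<^sup>2 \<le> \<bar>h x\<bar>\<^sup>2"
          using elim unfolding h_def by (intro power_mono abs_exp_diff_ge) (auto simp: N_def)
        then show ?case by (simp add: power_mult_distrib ennreal_leI flip: ennreal_mult)
      qed
    qed
    finally have *: "ennreal ((exp (- N))\<^sup>2) * (Lp_norm 2 \<mu> (\<lambda>x. \<Phi>1 x - \<Phi>2 x))\<^sup>2 \<le> (Lp_norm 2 \<mu> h)\<^sup>2"
      unfolding Lp_norm_2_power2 .
    have "ennreal ((exp (- N))\<^sup>2) / Z \<mu> \<Phi>1 * ((Lp_norm 2 \<mu> (\<lambda>x. \<Phi>1 x - \<Phi>2 x))\<^sup>2 / Lip_norm (supp \<mu>) h)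
        = 1 / Z \<mu> \<Phi>1 * (ennreal ((exp (- N))\<^sup>2) * (Lp_norm 2 \<mu> (\<lambda>x. \<Phi>1 x - \<Phi>2 x))\<^sup>2 / Lip_norm (supp \<mu>) h)"
      by (simp add: divide_ennreal_def ac_simps)
    also have "\<dots> \<le> 1 / Z \<mu> \<Phi>1 * ((Lp_norm 2 \<mu> h)\<^sup>2 / Lip_norm (supp \<mu>) h)"
      by (intro mult_left_mono divide_right_mono_ennreal *) simp
    also have "\<dots> \<le> W" by (rule lower[OF Z L])
    finally show ?thesis unfolding min .
  qed
  show ?thesis
    using upper upper' equal unequal dual attained lower lower'
    unfolding Let_def W_def B_def J_def F_def h_def z1_def z2_def by blast
qed

end
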